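(* Let $(A,\ast_1,\circ_1)$ be an anti-pre-Poisson algebra equipped with two comultiplications $\Delta,\delta:A\to A\otimes A$. Suppose that the dual maps $\ast_2=\Delta^*,\ \circ_2=\delta^*:A^*\otimes A^*\to A^*$ make $A^*$ into an anti-pre-Poisson algebra $(A^*,\ast_2,\circ_2)$. Then the following conditions are equivalent: (a) There is a quadratic anti-pre-Poisson algebra $(A\oplus A^*,\ast,\circ,\omega)$ such that $(A,\ast_1,\circ_1)$ and $(A^*,\ast_2,\circ_2)$ are anti-pre-Poisson subalgebras, where $\omega(x+a,y+b)=\langle x,b\rangle+\langle a,y\rangle$ for all $x,y\in A$, $a,b\in A^*$. (b) $(A,A^*,L_{\ast_1}^*,-L_{\circ_1}^*,L_{\ast_2}^*,-L_{\circ_2}^* )$ is a matched pair of Poisson algebras, where $A$ and $A^*$ carry their sub-adjacent Poisson algebra structures. (c) $(A,A^*,L_{\ast_1}^*+R_{\ast_1}^*,-R_{\ast_1}^*,R_{\circ_1}^*-L_{\circ_1}^*,R_{\circ_1}^*,L_{\ast_2}^*+R_{\ast_2}^*,-R_{\ast_2}^*,R_{\circ_2}^*-L_{\circ_2}^*,R_{\circ_2}^* )$ is a matched pair of anti-pre-Poisson algebras. (d) $(A,\ast_1,\circ_1,\Delta,\delta)$ is an anti-pre-Poisson bialgebra.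
   Context: Throughout, $k$ is a field and all vector spaces and algebras are finite-dimensional over $k$. Algebras. An anti-Zinbiel algebra $(A,\ast)$ is a vector space with a bilinear operation such that $x\ast(y\ast z)=-(x\ast y+y\ast x)\ast z=-(y\ast z+z\ast y)\ast x=z\ast(y\ast x)$ and $z\ast(x\ast y)=x\ast(z\ast y)$ for all $x,y,z$. An anti-pre-Lie algebra $(A,\circ)$ is a vector space with a bilinear operation such that, with $[x,y]=x\circ y-y\circ x$, $x\circ(y\circ z)-y\circ(x\circ z)=[y,x]\circ z$ and $[x,y]\circ z+[y,z]\circ x+[z,x]\circ y=0$. An anti-pre-Poisson algebra $(A,\ast,\circ)$ consists of an anti-Zinbiel algebra $(A,\ast)$ and an anti-pre-Lie algebra $(A,\circ)$ with $(x\circ y-y\circ x)\ast z=y\ast(x\circ z)-x\circ(y\ast z)$, $(x\ast y+y\ast x)\circ z=-x\ast(y\circ z)-y\ast(x\circ z)$, and $z\circ(x\ast y+y\ast x)+x\ast(y\circ z)+y\ast(x\circ z)=x\ast(z\circ y)+y\ast(z\circ x)$. Put $x\star y=x\ast y+y\ast x$; then $(A,\star,[\ ,\ ])$ is a Poisson algebra (commutative associative product, Lie bracket, $[z,x\star y]=[z,x]\star y+x\star[z,y]$), called the sub-adjacent Poisson algebra. Operators. $L_\ast(x)y=x\ast y$, $R_\ast(x)y=y\ast x$ (similarly for other operations), $\mathrm{ad}(x)=L_\circ(x)-R_\circ(x)$, $L_\star=L_\ast+R_\ast$. For $f:A\to\mathrm{End}(V)$, $f^*:A\to\mathrm{End}(V^*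 )$ is given by $\langle f^*(x)u^*,v\rangle=-\langle u^*,f(x)v\rangle$. $\tau(x\otimes y)=y\otimes x$; $I$ is the identity. Dual operations: $\langle\Delta(x),\zeta\otimes\eta\rangle=\langle x,\zeta\ast_2\eta\rangle$ and $\langle\delta(x),\zeta\otimes\eta\rangle=\langle x,\zeta\circ_2\eta\rangle$. Quadratic anti-pre-Poisson algebra $(A,\ast,\circ,\omega)$: an anti-pre-Poisson algebra with a non-degenerate symmetric bilinear form $\omega$ such that $\omega(x\ast y,z)=-\omega(y,x\star z)$ and $\omega(x\circ y,z)=\omega(y,[x,z])$ for all $x,y,z$. Matched pair of Poisson algebras. Given Poisson algebras $(P_i,\star_i,[\ ,\ ]_i)$, $i=1,2$, and linear maps $\mu_1,\rho_1:P_1\to\mathrm{End}(P_2)$, $\mu_2,\rho_2:P_2\to\mathrm{End}(P_1)$, the tuple $(P_1,P_2,\mu_1,\rho_1,\mu_2,\rho_2)$ is a matched pair of Poisson algebras if $P_1\oplus P_2$ is a Poisson algebra with $(x+a)\star(y+b)=x\star_1y+\mu_2(a)y+\mu_2(b)x+a\star_2b+\mu_1(x)b+\mu_1(y)a$ and $[x+a,y+b]=[x,y]_1+\rho_2(a)y-\rho_2(b)x+[a,b]_2+\rho_1(x)b-\rho_1(y)a$. Matched pair of anti-pre-Poisson algebras. Given anti-pre-Poisson algebras $(A_i,\ast_i,\circ_i)$ and linear maps $l_1,r_1,\rho_1,\mu_1:A_1\to\mathrm{End}(A_2)$, $l_2,r_2,\rho_2,\mu_2:A_2\to\mathrm{End}(A_1)$,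 the tuple $(A_1,A_2,l_1,r_1,\rho_1,\mu_1,l_2,r_2,\rho_2,\mu_2)$ is a matched pair if $A_1\oplus A_2$ is an anti-pre-Poisson algebra with $(x+a)\ast(y+b)=x\ast_1y+l_2(a)y+r_2(b)x+a\ast_2b+l_1(x)b+r_1(y)a$ and $(x+a)\circ(y+b)=x\circ_1y+\rho_2(a)y+\mu_2(b)x+a\circ_2b+\rho_1(x)b+\mu_1(y)a$. Anti-pre-Poisson bialgebra $(A,\ast,\circ,\Delta,\delta)$: $(A,\ast,\circ)$ is an anti-pre-Poisson algebra; $(A,\Delta,\delta)$ is an anti-pre-Poisson coalgebra, i.e. (equivalently) the duals $\Delta^*,\delta^*$ make $A^*$ an anti-pre-Poisson algebra; and for all $x,y\in A$: (1) $\Delta(x\star y)=(I\otimes L_\star(x))\Delta(y)-(L_\ast(y)\otimes I)\Delta(x)$; (2) $(\Delta+\tau\Delta)(x\ast y)=(L_\ast(x)\otimes I)(\Delta+\tau\Delta)(y)-(I\otimes R_\ast(y))\Delta(x)$; (3) $\delta([x,y])=(I\otimes\mathrm{ad}(x)-L_\circ(x)\otimes I)\delta(y)-(I\otimes\mathrm{ad}(y)-L_\circ(y)\otimes I)\delta(x)$; (4) $(I\otimes I-\tau)\big(\delta(x\circ y)-(L_\circ(x)\otimes I)\delta(y)-(I\otimes L_\circ(x))\delta(y)+(I\otimes R_\circ(y))\delta(x)\big)=0$; (5) $\delta(x\star y)=(I\otimes L_\star(x))\delta(y)+(I\otimes L_\star(y))\delta(x)+(L_\circ(x)\otimes I)\Delta(y)+(L_\circ(y)\otimes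 I)\Delta(x)$; (6) $\Delta([x,y])=-(L_\circ(x)\otimes I)\Delta(y)-(I\otimes L_\star(y))\delta(x)-(L_\ast(y)\otimes I)\delta(x)+(I\otimes\mathrm{ad}(x))\Delta(y)$; (7) $(\Delta+\tau\Delta)(x\circ y)=(I\otimes I+\tau)\big((L_\circ(x)\otimes I)\Delta(y)+(I\otimes L_\circ(x))\Delta(y)+(I\otimes R_\ast(y))\delta(x)\big)$; (8) $\delta(x\ast y)-\tau\delta(x\ast y)=(I\otimes L_\ast(x))\delta(y)-\tau(L_\ast(x)\otimes I)\delta(y)-(L_\circ(x)\otimes I)\Delta(y)-\tau(I\otimes L_\circ(x))\Delta(y)-(I\otimes R_\ast(y))\delta(x)-\tau(I\otimes R_\circ(y))\Delta(x)$.
   Formalization: The field k is additionally assumed to have characteristic different from 2; over fields of characteristic 2 condition (b) does not imply (c), so the stated equivalence fails there. *)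

theory Defs
  imports Complex_Main "HOL-Library.Function_Algebras" "HOL-Library.Product_Plus"
begin

text \<open>
  All structures live on a subspace V of an ambient vector space, because the dual of A is the set of
  linear functionals inside the function type, and the direct sum of A with its dual is a set of pairs.
  Operations are only constrained on the carriers U, V, W.
\<close>

section \<open>Multilinear preliminaries\<close>

definition bilinear_map ::
  "('k::field \<Rightarrow> 'u::ab_group_add \<Rightarrow> 'u) \<Rightarrow> 'u set \<Rightarrow>
   ('k \<Rightarrow> 'v::ab_group_add \<Rightarrow> 'v) \<Rightarrow> 'v set \<Rightarrow>
   ('k \<Rightarrow> 'w::ab_group_add \<Rightarrow> 'w) \<Rightarrow> 'w set \<Rightarrow> ('u \<Rightarrow> 'v \<Rightarrow> 'w) \<Rightarrow> bool"
  where "bilinear_map sU U sV V sW W m \<longleftrightarrow>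
    (\<forall>x\<in>U. \<forall>y\<in>V. m x y \<in> W) \<and>
    (\<forall>x\<in>U. \<forall>x'\<in>U. \<forall>y\<in>V. m (x + x') y = m x y + m x' y) \<and>
    (\<forall>x\<in>U. \<forall>y\<in>V. \<forall>y'\<in>V. m x (y + y') = m x y + m x y') \<and>
    (\<forall>c. \<forall>x\<in>U. \<forall>y\<in>V. m (sU c x) y = sW c (m x y) \<and> m x (sV c y) = sW c (m x y))"

text \<open>A linear map from V to End(W), in curried form.\<close>

abbreviation linear_to_End ::
  "('k::field \<Rightarrow> 'v::ab_group_add \<Rightarrow> 'v) \<Rightarrow> 'v set \<Rightarrow>
   ('k \<Rightarrow> 'w::ab_group_add \<Rightarrow> 'w) \<Rightarrow> 'w set \<Rightarrow> ('v \<Rightarrow> 'w \<Rightarrow> 'w) \<Rightarrow> bool"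
  where "linear_to_End sV V sW W f \<equiv> bilinear_map sV V sW W sW W f"

definition fun_scale :: "('k \<Rightarrow> 'v \<Rightarrow> 'v) \<Rightarrow> 'k \<Rightarrow> ('i \<Rightarrow> 'v) \<Rightarrow> 'i \<Rightarrow> 'v"
  where "fun_scale sc c f = (\<lambda>i. sc c (f i))"

definition sum_scale :: "('k \<Rightarrow> 'v \<Rightarrow> 'v) \<Rightarrow> ('k \<Rightarrow> 'w \<Rightarrow> 'w) \<Rightarrow> 'k \<Rightarrow> 'v \<times> 'w \<Rightarrow> 'v \<times> 'w"
  where "sum_scale sV sW c p = (sV c (fst p), sW c (snd p))"

definition dual_space :: "('k::field \<Rightarrow> 'a::ab_group_add \<Rightarrow> 'a) \<Rightarrow> ('a \<Rightarrow> 'k) set"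
  where "dual_space s = {f. Vector_Spaces.linear s (*) f}"

abbreviation dual_scale :: "'k::field \<Rightarrow> ('a \<Rightarrow> 'k) \<Rightarrow> 'a \<Rightarrow> 'k"
  where "dual_scale \<equiv> fun_scale (*)"


section \<open>Algebras\<close>

locale algebra_on = vector_space s
  for s :: "'k::field \<Rightarrow> 'v::ab_group_add \<Rightarrow> 'v" +
  fixes V :: "'v set" and mult :: "'v \<Rightarrow> 'v \<Rightarrow> 'v"
  assumes carrier_subspace: "subspace V"
    and mult_bilinear: "bilinear_map s V s V s V mult"

locale anti_zinbiel_algebra = algebra_on s V ast
  for s :: "'k::field \<Rightarrow> 'v::ab_group_add \<Rightarrow> 'v" and V
    and ast :: "'v \<Rightarrow> 'v \<Rightarrow> 'v" (infixl "\<ast>" 70) +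
  assumes az1: "\<lbrakk>x \<in> V; y \<in> V; z \<in> V\<rbrakk> \<Longrightarrow> x \<ast> (y \<ast> z) = - ((x \<ast> y + y \<ast> x) \<ast> z)"
    and az2: "\<lbrakk>x \<in> V; y \<in> V; z \<in> V\<rbrakk> \<Longrightarrow> x \<ast> (y \<ast> z) = - ((y \<ast> z + z \<ast> y) \<ast> x)"
    and az3: "\<lbrakk>x \<in> V; y \<in> V; z \<in> V\<rbrakk> \<Longrightarrow> x \<ast> (y \<ast> z) = z \<ast> (y \<ast> x)"
    and az4: "\<lbrakk>x \<in> V; y \<in> V; z \<in> V\<rbrakk> \<Longrightarrow> z \<ast> (x \<ast> y) = x \<ast> (z \<ast> y)"

definition commutator :: "('v::ab_group_add \<Rightarrow> 'v \<Rightarrow> 'v) \<Rightarrow> 'v \<Rightarrow> 'v \<Rightarrow> 'v"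
  where "commutator m x y = m x y - m y x"

definition anticommutator :: "('v::ab_group_add \<Rightarrow> 'v \<Rightarrow> 'v) \<Rightarrow> 'v \<Rightarrow> 'v \<Rightarrow> 'v"
  where "anticommutator m x y = m x y + m y x"

locale anti_pre_Lie_algebra = algebra_on s V circ
  for s :: "'k::field \<Rightarrow> 'v::ab_group_add \<Rightarrow> 'v" and V
    and circ :: "'v \<Rightarrow> 'v \<Rightarrow> 'v" (infixl "\<odot>" 70) +
  assumes apl1: "\<lbrakk>x \<in> V; y \<in> V; z \<in> V\<rbrakk> \<Longrightarrow>
      x \<odot> (y \<odot> z) - y \<odot> (x \<odot> z) = commutator (\<odot>) y x \<odot> z"
    and apl2: "\<lbrakk>x \<in> V; y \<in> V; z \<in> V\<rbrakk> \<Longrightarrow>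
      commutator (\<odot>) x y \<odot> z + commutator (\<odot>) y z \<odot> x + commutator (\<odot>) z x \<odot> y = 0"

locale anti_pre_Poisson_algebra =
  anti_zinbiel_algebra s V ast + anti_pre_Lie_algebra s V circ
  for s :: "'k::field \<Rightarrow> 'v::ab_group_add \<Rightarrow> 'v" and V
    and ast :: "'v \<Rightarrow> 'v \<Rightarrow> 'v" (infixl "\<ast>" 70)
    and circ :: "'v \<Rightarrow> 'v \<Rightarrow> 'v" (infixl "\<odot>" 70) +
  assumes app1: "\<lbrakk>x \<in> V; y \<in> V; z \<in> V\<rbrakk> \<Longrightarrow>
      (x \<odot> y - y \<odot> x) \<ast> z = y \<ast> (x \<odot> z) - x \<odot> (y \<ast> z)"
    and app2: "\<lbrakk>x \<in> V; y \<in> V; z \<in> V\<rbrakk> \<Longrightarrow>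
      (x \<ast> y + y \<ast> x) \<odot> z = - (x \<ast> (y \<odot> z)) - y \<ast> (x \<odot> z)"
    and app3: "\<lbrakk>x \<in> V; y \<in> V; z \<in> V\<rbrakk> \<Longrightarrow>
      z \<odot> (x \<ast> y + y \<ast> x) + x \<ast> (y \<odot> z) + y \<ast> (x \<odot> z) = x \<ast> (z \<odot> y) + y \<ast> (z \<odot> x)"

locale Poisson_algebra = comm: algebra_on s V star + lie: algebra_on s V br
  for s :: "'k::field \<Rightarrow> 'v::ab_group_add \<Rightarrow> 'v" and V
    and star :: "'v \<Rightarrow> 'v \<Rightarrow> 'v" (infixl "\<star>" 70)
    and br :: "'v \<Rightarrow> 'v \<Rightarrow> 'v" +
  assumes star_commute: "\<lbrakk>x \<in> V; y \<in> V\<rbrakk> \<Longrightarrow> x \<star> y = y \<star> x"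
    and star_assoc: "\<lbrakk>x \<in> V; y \<in> V; z \<in> V\<rbrakk> \<Longrightarrow> (x \<star> y) \<star> z = x \<star> (y \<star> z)"
    and br_alternating: "x \<in> V \<Longrightarrow> br x x = 0"
    and jacobi: "\<lbrakk>x \<in> V; y \<in> V; z \<in> V\<rbrakk> \<Longrightarrow>
      br (br x y) z + br (br y z) x + br (br z x) y = 0"
    and leibniz: "\<lbrakk>x \<in> V; y \<in> V; z \<in> V\<rbrakk> \<Longrightarrow> br z (x \<star> y) = br z x \<star> y + x \<star> br z y"

locale quadratic_anti_pre_Poisson_algebra =
  anti_pre_Poisson_algebra s V ast circ
  for s :: "'k::field \<Rightarrow> 'v::ab_group_add \<Rightarrow> 'v" and V
    and ast :: "'v \<Rightarrow> 'v \<Rightarrow> 'v" (infixl "\<ast>" 70)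
    and circ :: "'v \<Rightarrow> 'v \<Rightarrow> 'v" (infixl "\<odot>" 70) +
  fixes \<omega> :: "'v \<Rightarrow> 'v \<Rightarrow> 'k"
  assumes form_bilinear: "bilinear_map s V s V (*) UNIV \<omega>"
    and form_symmetric: "\<lbrakk>x \<in> V; y \<in> V\<rbrakk> \<Longrightarrow> \<omega> x y = \<omega> y x"
    and form_nondegenerate: "\<lbrakk>x \<in> V; \<And>y. y \<in> V \<Longrightarrow> \<omega> x y = 0\<rbrakk> \<Longrightarrow> x = 0"
    and form_ast: "\<lbrakk>x \<in> V; y \<in> V; z \<in> V\<rbrakk> \<Longrightarrow> \<omega> (x \<ast> y) z = - \<omega> y (anticommutator (\<ast>) x z)"
    and form_circ: "\<lbrakk>x \<in> V; y \<in> V; z \<in> V\<rbrakk> \<Longrightarrow> \<omega> (x \<odot> y) z = \<omega> y (commutator (\<odot>) x z)"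

text \<open>
  V with its own operations is a subalgebra of the algebra (ast, circ) along the linear embedding i;
  below, i is one of the two inclusions into a direct sum.
\<close>

definition subalgebra_via ::
  "('v \<Rightarrow> 'w) \<Rightarrow> 'v set \<Rightarrow> ('v \<Rightarrow> 'v \<Rightarrow> 'v) \<Rightarrow> ('v \<Rightarrow> 'v \<Rightarrow> 'v) \<Rightarrow>
   ('w \<Rightarrow> 'w \<Rightarrow> 'w) \<Rightarrow> ('w \<Rightarrow> 'w \<Rightarrow> 'w) \<Rightarrow> bool"
  where "subalgebra_via i V ast0 circ0 ast circ \<longleftrightarrow>
    (\<forall>x\<in>V. \<forall>y\<in>V. ast (i x) (i y) = i (ast0 x y) \<and> circ (i x) (i y) = i (circ0 x y))"


section \<open>Matched pairs\<close>

definition matched_pair_Poisson where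
  "matched_pair_Poisson s1 P1 star1 br1 s2 P2 star2 br2 \<mu>1 \<rho>1 \<mu>2 \<rho>2 \<longleftrightarrow>
    Poisson_algebra s1 P1 star1 br1 \<and> Poisson_algebra s2 P2 star2 br2 \<and>
    linear_to_End s1 P1 s2 P2 \<mu>1 \<and> linear_to_End s1 P1 s2 P2 \<rho>1 \<and>
    linear_to_End s2 P2 s1 P1 \<mu>2 \<and> linear_to_End s2 P2 s1 P1 \<rho>2 \<and>
    Poisson_algebra (sum_scale s1 s2) (P1 \<times> P2)
      (\<lambda>(x, a) (y, b). (star1 x y + \<mu>2 a y + \<mu>2 b x, star2 a b + \<mu>1 x b + \<mu>1 y a))
      (\<lambda>(x, a) (y, b). (br1 x y + \<rho>2 a y - \<rho>2 b x, br2 a b + \<rho>1 x b - \<rho>1 y a))"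

definition matched_pair_anti_pre_Poisson where
  "matched_pair_anti_pre_Poisson s1 A1 ast1 circ1 s2 A2 ast2 circ2 l1 r1 \<rho>1 \<mu>1 l2 r2 \<rho>2 \<mu>2 \<longleftrightarrow>
    anti_pre_Poisson_algebra s1 A1 ast1 circ1 \<and> anti_pre_Poisson_algebra s2 A2 ast2 circ2 \<and>
    linear_to_End s1 A1 s2 A2 l1 \<and> linear_to_End s1 A1 s2 A2 r1 \<and>
    linear_to_End s1 A1 s2 A2 \<rho>1 \<and> linear_to_End s1 A1 s2 A2 \<mu>1 \<and>
    linear_to_End s2 A2 s1 A1 l2 \<and> linear_to_End s2 A2 s1 A1 r2 \<and>
    linear_to_End s2 A2 s1 A1 \<rho>2 \<and> linear_to_End s2 A2 s1 A1 \<mu>2 \<and>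
    anti_pre_Poisson_algebra (sum_scale s1 s2) (A1 \<times> A2)
      (\<lambda>(x, a) (y, b). (ast1 x y + l2 a y + r2 b x, ast2 a b + l1 x b + r1 y a))
      (\<lambda>(x, a) (y, b). (circ1 x y + \<rho>2 a y + \<mu>2 b x, circ2 a b + \<rho>1 x b + \<mu>1 y a))"


section \<open>Multiplication operators and their duals\<close>

definition Lmul :: "('v \<Rightarrow> 'v \<Rightarrow> 'v) \<Rightarrow> 'v \<Rightarrow> 'v \<Rightarrow> 'v"
  where "Lmul m x y = m x y"

definition Rmul :: "('v \<Rightarrow> 'v \<Rightarrow> 'v) \<Rightarrow> 'v \<Rightarrow> 'v \<Rightarrow> 'v"
  where "Rmul m x y = m y x"

text \<open>The dual of a map A to End(A), acting on the dual of A.\<close>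

definition dual_action :: "('a \<Rightarrow> 'a \<Rightarrow> 'a) \<Rightarrow> 'a \<Rightarrow> ('a \<Rightarrow> 'k::field) \<Rightarrow> 'a \<Rightarrow> 'k"
  where "dual_action f x u = (\<lambda>v. - u (f x v))"

text \<open>
  For a map f from the dual A' of A to End(A'), the dual map acts on A'' = A. For finite-dimensional A
  the vector described here exists and is unique, see \<open>bidual_action_eq\<close> below.
\<close>

definition bidual_action ::
  "('k::field \<Rightarrow> 'a::ab_group_add \<Rightarrow> 'a) \<Rightarrow> (('a \<Rightarrow> 'k) \<Rightarrow> ('a \<Rightarrow> 'k) \<Rightarrow> ('a \<Rightarrow> 'k)) \<Rightarrow>
   ('a \<Rightarrow> 'k) \<Rightarrow> 'a \<Rightarrow> 'a"
  where "bidual_action s f a x = (THE y. \<forall>b\<in>dual_space s. b y = - f a b x)"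


section \<open>The tensor square\<close>

text \<open>
  For finite-dimensional A, the tensor square of A is realised as the space of bilinear forms on the
  dual of A, where the pure tensor of x and y is the form sending (\<zeta>, \<eta>) to \<zeta>(x) \<eta>(y). Thus the
  pairing of a tensor t with the tensor product of \<zeta> and \<eta> is \<open>t \<zeta> \<eta>\<close>. The forms are set to 0 off the
  dual space so that equality of tensors is equality in HOL. The lemmas \<open>tensor_square_eq_span\<close> and
  \<open>tensor_square_universal\<close> below show that this is the tensor product.
\<close>

definition tensor_square ::
  "('k::field \<Rightarrow> 'a::ab_group_add \<Rightarrow> 'a) \<Rightarrow> (('a \<Rightarrow> 'k) \<Rightarrow> ('a \<Rightarrow> 'k) \<Rightarrow> 'k) set"
  where "tensor_square s = {t.
    bilinear_map dual_scale (dual_space s) dual_scale (dual_space s) (*) UNIV t \<and>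
    (\<forall>\<zeta> \<eta>. \<zeta> \<notin> dual_space s \<or> \<eta> \<notin> dual_space s \<longrightarrow> t \<zeta> \<eta> = 0)}"

abbreviation tensor_scale :: "'k::field \<Rightarrow> ('d \<Rightarrow> 'd \<Rightarrow> 'k) \<Rightarrow> 'd \<Rightarrow> 'd \<Rightarrow> 'k"
  where "tensor_scale \<equiv> fun_scale (fun_scale (*))"

definition pure_tensor ::
  "('k::field \<Rightarrow> 'a::ab_group_add \<Rightarrow> 'a) \<Rightarrow> 'a \<Rightarrow> 'a \<Rightarrow> ('a \<Rightarrow> 'k) \<Rightarrow> ('a \<Rightarrow> 'k) \<Rightarrow> 'k"
  where "pure_tensor s x y =
    (\<lambda>\<zeta> \<eta>. if \<zeta> \<in> dual_space s \<and> \<eta> \<in> dual_space s then \<zeta> x * \<eta> y else 0)"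

definition tensor_map ::
  "('k::field \<Rightarrow> 'a::ab_group_add \<Rightarrow> 'a) \<Rightarrow> ('a \<Rightarrow> 'a) \<Rightarrow> ('a \<Rightarrow> 'a) \<Rightarrow>
   (('a \<Rightarrow> 'k) \<Rightarrow> ('a \<Rightarrow> 'k) \<Rightarrow> 'k) \<Rightarrow> ('a \<Rightarrow> 'k) \<Rightarrow> ('a \<Rightarrow> 'k) \<Rightarrow> 'k"
  where "tensor_map s f g t =
    (\<lambda>\<zeta> \<eta>. if \<zeta> \<in> dual_space s \<and> \<eta> \<in> dual_space s then t (\<zeta> \<circ> f) (\<eta> \<circ> g) else 0)"

definition twist :: "('d \<Rightarrow> 'd \<Rightarrow> 'k) \<Rightarrow> 'd \<Rightarrow> 'd \<Rightarrow> 'k"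
  where "twist t = (\<lambda>\<zeta> \<eta>. t \<eta> \<zeta>)"

definition comultiplication ::
  "('k::field \<Rightarrow> 'a::ab_group_add \<Rightarrow> 'a) \<Rightarrow> ('a \<Rightarrow> ('a \<Rightarrow> 'k) \<Rightarrow> ('a \<Rightarrow> 'k) \<Rightarrow> 'k) \<Rightarrow> bool"
  where "comultiplication s D \<longleftrightarrow>
    (\<forall>x. D x \<in> tensor_square s) \<and> Vector_Spaces.linear s tensor_scale D"

definition dual_mult ::
  "('a \<Rightarrow> ('a \<Rightarrow> 'k) \<Rightarrow> ('a \<Rightarrow> 'k) \<Rightarrow> 'k) \<Rightarrow> ('a \<Rightarrow> 'k) \<Rightarrow> ('a \<Rightarrow> 'k) \<Rightarrow> 'a \<Rightarrow> 'k"
  where "dual_mult D \<zeta> \<eta> = (\<lambda>x. D x \<zeta> \<eta>)"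


section \<open>Bialgebras\<close>

definition anti_pre_Poisson_coalgebra where
  "anti_pre_Poisson_coalgebra s \<Delta> \<delta> \<longleftrightarrow>
    comultiplication s \<Delta> \<and> comultiplication s \<delta> \<and>
    anti_pre_Poisson_algebra dual_scale (dual_space s) (dual_mult \<Delta>) (dual_mult \<delta>)"

definition anti_pre_Poisson_bialgebra ::
  "('k::field \<Rightarrow> 'a::ab_group_add \<Rightarrow> 'a) \<Rightarrow> ('a \<Rightarrow> 'a \<Rightarrow> 'a) \<Rightarrow> ('a \<Rightarrow> 'a \<Rightarrow> 'a) \<Rightarrow>
   ('a \<Rightarrow> ('a \<Rightarrow> 'k) \<Rightarrow> ('a \<Rightarrow> 'k) \<Rightarrow> 'k) \<Rightarrow> ('a \<Rightarrow> ('a \<Rightarrow> 'k) \<Rightarrow> ('a \<Rightarrow> 'k) \<Rightarrow> 'k) \<Rightarrow> bool"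
  where "anti_pre_Poisson_bialgebra s ast circ \<Delta> \<delta> \<longleftrightarrow>
    anti_pre_Poisson_algebra s UNIV ast circ \<and> anti_pre_Poisson_coalgebra s \<Delta> \<delta> \<and>
    (let star = anticommutator ast; br = commutator circ;
         La = Lmul ast; Ra = Rmul ast; Lc = Lmul circ; Rc = Rmul circ;
         Ls = La + Ra; ad = Lc - Rc; T = tensor_map s; \<tau> = twist
     in \<forall>x y.
      \<Delta> (star x y) = T id (Ls x) (\<Delta> y) - T (La y) id (\<Delta> x) \<and>
      (\<Delta> + (\<tau> \<circ> \<Delta>)) (ast x y) = T (La x) id ((\<Delta> + (\<tau> \<circ> \<Delta>)) y) - T id (Ra y) (\<Delta> x) \<and>
      \<delta> (br x y) = (T id (ad x) - T (Lc x) id) (\<delta> y) - (T id (ad y) - T (Lc y) id) (\<delta> x) \<and>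
      (id - \<tau>) (\<delta> (circ x y) - T (Lc x) id (\<delta> y) - T id (Lc x) (\<delta> y) + T id (Rc y) (\<delta> x)) = 0 \<and>
      \<delta> (star x y) = T id (Ls x) (\<delta> y) + T id (Ls y) (\<delta> x)
        + T (Lc x) id (\<Delta> y) + T (Lc y) id (\<Delta> x) \<and>
      \<Delta> (br x y) = - T (Lc x) id (\<Delta> y) - T id (Ls y) (\<delta> x) - T (La y) id (\<delta> x) + T id (ad x) (\<Delta> y) \<and>
      (\<Delta> + (\<tau> \<circ> \<Delta>)) (circ x y) =
        (id + \<tau>) (T (Lc x) id (\<Delta> y) + T id (Lc x) (\<Delta> y) + T id (Ra y) (\<delta> x)) \<and>
      \<delta> (ast x y) - \<tau> (\<delta> (ast x y)) =
        T id (La x) (\<delta> y) - \<tau> (T (La x) id (\<delta> y)) - T (Lc x) id (\<Delta> y)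
        - \<tau> (T id (Lc x) (\<Delta> y)) - T id (Ra y) (\<delta> x) - \<tau> (T id (Rc y) (\<Delta> x)))"


section \<open>Adequacy of the encodings\<close>

lemma dual_space_iff:
  fixes s :: "'k::field \<Rightarrow> 'a::ab_group_add \<Rightarrow> 'a"
  assumes "vector_space s"
  shows "f \<in> dual_space s \<longleftrightarrow> (\<forall>x y. f (x + y) = f x + f y) \<and> (\<forall>c x. f (s c x) = c * f x)"
proof -
  interpret vector_space s by fact
  interpret K: vector_space "(*) :: 'k \<Rightarrow> 'k \<Rightarrow> 'k"
    by standard (simp_all add: algebra_simps)
  show ?thesis
    unfolding dual_space_def by (auto simp: Vector_Spaces.linear_iff vector_space_axioms K.vector_space_axioms)
qed

lemma vector_space_fun_scale:
  assumes "vector_space sc"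
  shows "vector_space (fun_scale sc)"
proof -
  interpret vector_space sc by fact
  show ?thesis
    by standard (auto simp: fun_scale_def fun_eq_iff scale_right_distrib scale_left_distrib)
qed

lemma vector_space_field: "vector_space ((*) :: 'k::field \<Rightarrow> 'k \<Rightarrow> 'k)"
  by standard (simp_all add: algebra_simps)

lemma vector_space_sum_scale:
  assumes "vector_space s1" "vector_space s2"
  shows "vector_space (sum_scale s1 s2)"
proof -
  interpret a: vector_space s1 by fact
  interpret b: vector_space s2 by fact
  show ?thesis
    by standard (auto simp: sum_scale_def a.scale_right_distrib a.scale_left_distrib
        b.scale_right_distrib b.scale_left_distrib)
qed

lemma sum_fun_apply: "(\<Sum>i\<in>I. f i) x = (\<Sum>i\<in>I. f i x)"
  by (induction I rule: infinite_finite_induct) auto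

lemma twist_pure_tensor: "twist (pure_tensor s x y) = pure_tensor s y x"
  by (auto simp: twist_def pure_tensor_def fun_eq_iff mult.commute)

context finite_dimensional_vector_space
begin

lemma tensor_map_pure_tensor:
  assumes "Vector_Spaces.linear scale scale f" "Vector_Spaces.linear scale scale g"
  shows "tensor_map scale f g (pure_tensor scale x y) = pure_tensor scale (f x) (g y)"
proof -
  interpret f: Vector_Spaces.linear scale scale f by fact
  interpret g: Vector_Spaces.linear scale scale g by fact
  have "\<zeta> \<circ> f \<in> dual_space scale \<and> \<zeta> \<circ> g \<in> dual_space scale" if "\<zeta> \<in> dual_space scale" for \<zeta>
    using that by (simp add: dual_space_iff vector_space_axioms f.add g.add f.scale g.scale)
  then show ?thesis
    by (auto simp: tensor_map_def pure_tensor_def fun_eq_iff)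
qed

definition dual_basis :: "'b \<Rightarrow> 'b \<Rightarrow> 'a"
  where "dual_basis b = (\<lambda>v. representation Basis v b)"

lemma dual_basis_in: "dual_basis b \<in> dual_space scale"
  by (simp add: dual_space_iff vector_space_axioms dual_basis_def representation_add
      representation_scale independent_Basis span_Basis)

lemma sum_dual_basis_vector: "(\<Sum>b\<in>Basis. dual_basis b v *s b) = v"
  unfolding dual_basis_def
  by (rule sum_representation_eq[OF independent_Basis]) (auto simp: span_Basis finite_Basis)

lemma dual_space_sum:
  assumes "\<zeta> \<in> dual_space scale"
  shows "\<zeta> (\<Sum>b\<in>B. g b *s b) = (\<Sum>b\<in>B. g b * \<zeta> b)"
proof -
  have z: "\<zeta> 0 = 0"
    using assms by (metis add_cancel_right_right dual_space_iff vector_space_axioms)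
  show ?thesis
    using assms
    by (induction B rule: infinite_finite_induct)
       (auto simp: z dual_space_iff vector_space_axioms)
qed

lemma dual_basis_expand:
  assumes "\<zeta> \<in> dual_space scale"
  shows "\<zeta> = (\<Sum>b\<in>Basis. dual_scale (\<zeta> b) (dual_basis b))"
proof
  fix v
  have "\<zeta> v = \<zeta> (\<Sum>b\<in>Basis. dual_basis b v *s b)" by (simp add: sum_dual_basis_vector)
  also have "\<dots> = (\<Sum>b\<in>Basis. dual_basis b v * \<zeta> b)" by (rule dual_space_sum[OF assms])
  also have "\<dots> = (\<Sum>b\<in>Basis. dual_scale (\<zeta> b) (dual_basis b)) v"
    by (simp add: fun_scale_def sum_fun_apply mult.commute)
  finally show "\<zeta> v = (\<Sum>b\<in>Basis. dual_scale (\<zeta> b) (dual_basis b)) v" .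
qed

lemma subspace_dual: "module.subspace dual_scale (dual_space scale)"
proof -
  interpret D: vector_space "dual_scale :: 'a \<Rightarrow> ('b \<Rightarrow> 'a) \<Rightarrow> _"
    by (intro vector_space_fun_scale vector_space_field)
  show ?thesis
    by (auto simp: D.subspace_def dual_space_iff vector_space_axioms fun_scale_def algebra_simps)
qed

lemma linear_on_dual_sum:
  assumes add: "\<And>a b. a \<in> dual_space scale \<Longrightarrow> b \<in> dual_space scale \<Longrightarrow> \<Phi> (a + b) = \<Phi> a + \<Phi> b"
    and sc: "\<And>c a. a \<in> dual_space scale \<Longrightarrow> \<Phi> (dual_scale c a) = c * \<Phi> a"
    and \<zeta>: "\<zeta> \<in> dual_space scale"
  shows "\<Phi> \<zeta> = (\<Sum>b\<in>Basis. \<zeta> b * \<Phi> (dual_basis b))"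
proof -
  interpret D: vector_space "dual_scale :: 'a \<Rightarrow> ('b \<Rightarrow> 'a) \<Rightarrow> _"
    by (intro vector_space_fun_scale vector_space_field)
  have S: "dual_scale (\<zeta> b) (dual_basis b) \<in> dual_space scale" for b
    by (rule D.subspace_scale[OF subspace_dual dual_basis_in])
  have "0 \<in> dual_space scale" by (rule D.subspace_0[OF subspace_dual])
  then have "\<Phi> 0 + \<Phi> 0 = \<Phi> 0 + 0" using add[of 0 0] by simp
  then have z: "\<Phi> 0 = 0" by (simp only: add_left_cancel)
  have "\<Phi> (\<Sum>b\<in>B. dual_scale (\<zeta> b) (dual_basis b)) = (\<Sum>b\<in>B. \<zeta> b * \<Phi> (dual_basis b))" if "finite B" for B
    using that
    by induction
       (simp_all add: z add S sc dual_basis_in D.subspace_sum[OF subspace_dual]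
         del: plus_fun_apply sum_fun_apply zero_fun_apply flip: zero_fun_def)
  from this[OF finite_Basis] show ?thesis
    using dual_basis_expand[OF \<zeta>] by simp
qed

lemma dual_separates:
  assumes "\<And>b. b \<in> dual_space scale \<Longrightarrow> b x = b y"
  shows "x = y"
  by (metis (no_types, lifting) sum.cong sum_dual_basis_vector assms[OF dual_basis_in])

lemma ex1_bidual:
  assumes "\<And>a b. a \<in> dual_space scale \<Longrightarrow> b \<in> dual_space scale \<Longrightarrow> \<Phi> (a + b) = \<Phi> a + \<Phi> b"
    and "\<And>c a. a \<in> dual_space scale \<Longrightarrow> \<Phi> (dual_scale c a) = c * \<Phi> a"
  shows "\<exists>!y. \<forall>b\<in>dual_space scale. b y = \<Phi> b"
proof (rule ex_ex1I)
  have "a (\<Sum>b\<in>Basis. \<Phi> (dual_basis b) *s b) = \<Phi> a" if "a \<in> dual_space scale" for a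
    unfolding dual_space_sum[OF that]
    by (subst linear_on_dual_sum[of \<Phi>, OF assms that]) (simp_all add: mult.commute)
  then show "\<exists>y. \<forall>b\<in>dual_space scale. b y = \<Phi> b"
    by blast
next
  fix x y assume "\<forall>b\<in>dual_space scale. b x = \<Phi> b" "\<forall>b\<in>dual_space scale. b y = \<Phi> b"
  then show "x = y" by (intro dual_separates) simp
qed

lemma bidual_action_eq:
  assumes f: "linear_to_End dual_scale (dual_space scale) dual_scale (dual_space scale) f"
    and "a \<in> dual_space scale" "b \<in> dual_space scale"
  shows "b (bidual_action scale f a x) = - f a b x"
proof -
  have "\<exists>!y. \<forall>b\<in>dual_space scale. b y = - f a b x"
    using f \<open>a \<in> dual_space scale\<close>
    by (intro ex1_bidual) (simp_all add: bilinear_map_def fun_scale_def)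
  from theI'[OF this] show ?thesis
    using \<open>b \<in> dual_space scale\<close> by (simp add: bidual_action_def)
qed

lemma pure_tensor_in: "pure_tensor scale x y \<in> tensor_square scale"
proof -
  interpret D: vector_space "dual_scale :: 'a \<Rightarrow> ('b \<Rightarrow> 'a) \<Rightarrow> _"
    by (intro vector_space_fun_scale vector_space_field)
  show ?thesis
    by (auto simp: tensor_square_def pure_tensor_def bilinear_map_def fun_scale_def algebra_simps
        D.subspace_add[OF subspace_dual] D.subspace_scale[OF subspace_dual, unfolded fun_scale_def])
qed

lemma pure_tensor_bilinear:
  "bilinear_map scale UNIV scale UNIV tensor_scale (tensor_square scale) (pure_tensor scale)"
proof -
  have h: "\<zeta> (x + y) = \<zeta> x + \<zeta> y" "\<zeta> (c *s x) = c * \<zeta> x" if "\<zeta> \<in> dual_space scale" for \<zeta> c x y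
    using that by (simp_all add: dual_space_iff vector_space_axioms)
  show ?thesis
    unfolding bilinear_map_def
  proof (intro conjI ballI allI pure_tensor_in)
  qed (auto simp: pure_tensor_def fun_scale_def fun_eq_iff h ring_distribs)
qed

lemma tensor_expand:
  assumes "t \<in> tensor_square scale"
  shows "t = (\<Sum>b\<in>Basis. \<Sum>d\<in>Basis.
    tensor_scale (t (dual_basis b) (dual_basis d)) (pure_tensor scale b d))"
proof (intro ext)
  fix \<zeta> \<eta>
  have B: "bilinear_map dual_scale (dual_space scale) dual_scale (dual_space scale) (*) UNIV t"
    using assms by (simp add: tensor_square_def)
  show "t \<zeta> \<eta> = (\<Sum>b\<in>Basis. \<Sum>d\<in>Basis.
    tensor_scale (t (dual_basis b) (dual_basis d)) (pure_tensor scale b d)) \<zeta> \<eta>"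
  proof (cases "\<zeta> \<in> dual_space scale \<and> \<eta> \<in> dual_space scale")
    case True
    have "t \<zeta> \<eta> = (\<Sum>b\<in>Basis. \<zeta> b * t (dual_basis b) \<eta>)"
      using B True by (intro linear_on_dual_sum[of "\<lambda>\<zeta>. t \<zeta> \<eta>"]) (auto simp: bilinear_map_def)
    also have "\<dots> = (\<Sum>b\<in>Basis. \<zeta> b * (\<Sum>d\<in>Basis. \<eta> d * t (dual_basis b) (dual_basis d)))"
      using B True dual_basis_in
      by (intro sum.cong refl arg_cong2[of _ _ _ _ "(*)"] linear_on_dual_sum)
         (simp_all add: bilinear_map_def del: plus_fun_apply)
    also have "\<dots> = (\<Sum>b\<in>Basis. \<Sum>d\<in>Basis. t (dual_basis b) (dual_basis d) * (\<zeta> b * \<eta> d))"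
      by (simp add: sum_distrib_left algebra_simps)
    finally show ?thesis
      using True by (simp add: fun_scale_def pure_tensor_def sum_fun_apply)
  next
    case False
    then have "t \<zeta> \<eta> = 0"
      using assms by (auto simp: tensor_square_def)
    then show ?thesis
      using False by (auto simp: fun_scale_def pure_tensor_def sum_fun_apply)
  qed
qed

lemma tensor_square_eq_span:
  "tensor_square scale = module.span tensor_scale {pure_tensor scale x y | x y. True}"
proof -
  interpret T: vector_space "tensor_scale :: 'a \<Rightarrow> (('b \<Rightarrow> 'a) \<Rightarrow> ('b \<Rightarrow> 'a) \<Rightarrow> 'a) \<Rightarrow> _"
    by (intro vector_space_fun_scale vector_space_field)
  have sub: "T.subspace (tensor_square scale)"
    by (auto simp: T.subspace_def tensor_square_def bilinear_map_def fun_scale_def algebra_simps)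
  show ?thesis
  proof
    show "tensor_square scale \<subseteq> T.span {pure_tensor scale x y | x y. True}"
    proof
      fix t assume "t \<in> tensor_square scale"
      have "(\<Sum>b\<in>Basis. \<Sum>d\<in>Basis. tensor_scale (t (dual_basis b) (dual_basis d)) (pure_tensor scale b d))
        \<in> T.span {pure_tensor scale x y | x y. True}"
        by (intro T.span_sum T.span_scale T.span_base) blast
      with tensor_expand[OF \<open>t \<in> tensor_square scale\<close>]
      show "t \<in> T.span {pure_tensor scale x y | x y. True}"
        by simp
    qed
    show "T.span {pure_tensor scale x y | x y. True} \<subseteq> tensor_square scale"
      by (rule T.span_minimal[OF _ sub]) (auto simp: pure_tensor_in)
  qed
qed

lemma tensor_square_universal:
  fixes sW :: "'a \<Rightarrow> 'w::ab_group_add \<Rightarrow> 'w"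
  assumes W: "vector_space sW" and \<beta>: "bilinear_map scale UNIV scale UNIV sW UNIV \<beta>"
  shows "\<exists>L. Vector_Spaces.linear tensor_scale sW L \<and> (\<forall>x y. L (pure_tensor scale x y) = \<beta> x y)"
proof -
  interpret W: vector_space sW by fact
  interpret T: vector_space "tensor_scale :: 'a \<Rightarrow> (('b \<Rightarrow> 'a) \<Rightarrow> ('b \<Rightarrow> 'a) \<Rightarrow> 'a) \<Rightarrow> _"
    by (intro vector_space_fun_scale vector_space_field)
  define L where "L t = (\<Sum>b\<in>Basis. \<Sum>d\<in>Basis. sW (t (dual_basis b) (dual_basis d)) (\<beta> b d))" for t
  have lin: "Vector_Spaces.linear tensor_scale sW L"
    by (simp add: Vector_Spaces.linear_iff T.vector_space_axioms W L_def W.scale_left_distrib sum.distrib W.scale_sum_right)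
       (simp add: fun_scale_def)
  have b1: "Vector_Spaces.linear scale sW (\<lambda>x. \<beta> x y)" and b2: "Vector_Spaces.linear scale sW (\<beta> x)"
    for x y using \<beta> by (simp_all add: Vector_Spaces.linear_iff bilinear_map_def vector_space_axioms W)
  interpret b1: Vector_Spaces.linear scale sW "\<lambda>x. \<beta> x y" for y by (rule b1)
  interpret b2: Vector_Spaces.linear scale sW "\<beta> x" for x by (rule b2)
  have "L (pure_tensor scale x y) = \<beta> x y" for x y
  proof -
    have "\<beta> x y = \<beta> (\<Sum>b\<in>Basis. dual_basis b x *s b) (\<Sum>d\<in>Basis. dual_basis d y *s d)"
      by (simp only: sum_dual_basis_vector)
    also have "\<dots> = (\<Sum>b\<in>Basis. sW (dual_basis b x) (\<beta> b (\<Sum>d\<in>Basis. dual_basis d y *s d)))"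
      by (simp only: b1.sum b1.scale)
    also have "\<dots> = (\<Sum>b\<in>Basis. \<Sum>d\<in>Basis. sW (dual_basis b x * dual_basis d y) (\<beta> b d))"
      by (simp only: b2.sum b2.scale W.scale_sum_right W.scale_scale)
    finally show ?thesis
      by (simp add: L_def pure_tensor_def dual_basis_in)
  qed
  with lin show ?thesis by blast
qed

end

end

theory Submission
  imports Defs
begin

text \<open>
  Write \<open>W\<close> for the direct sum of \<open>A\<close> and its dual, \<open>\<omega>\<close> for the natural pairing on \<open>W\<close>, and
  \<open>x \<star> y\<close>, \<open>[x, y]\<close> for the anticommutator of \<open>\<ast>\<close> and the commutator of \<open>\<circ>\<close>. All four conditions
  are statements about one and the same pair of products on \<open>W\<close>, those of (c).

  The invariance of \<open>\<omega>\<close>, namely \<open>\<omega> (x \<ast> y) z = - \<omega> y (x \<star> z)\<close> and \<open>\<omega> (x \<circ> y) z = \<omega> y [x, z]\<close>, says that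
  \<open>(x, y, z) \<mapsto> \<omega> (x \<ast> y) z\<close> is symmetric in its outer arguments, that \<open>(x, y, z) \<mapsto> \<omega> (x \<circ> y) z\<close> is
  skew in them, and that both have vanishing cyclic sum. Of three homogeneous elements of \<open>W\<close> two lie
  in the same summand, so these symmetries compute the products on \<open>W\<close> from those of the two summands
  (\<open>invariant_products_unique\<close>). The products of (c) are invariant, hence are the only candidates in
  (a), and (a) is equivalent to (c) (\<open>quadratic_iff_double\<close>).

  The star product and the bracket derived from the products of (c) are the operations of (b). An
  anti-pre-Poisson algebra always yields a Poisson algebra (\<open>sub_adjacent_Poisson\<close>). Conversely, the
  invariance expresses \<open>\<ast>\<close> and \<open>\<circ>\<close> through \<open>\<star>\<close>, \<open>[ , ]\<close> and \<open>\<omega>\<close>, and for a Poisson algebra with such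
  a form the anti-pre-Poisson identities follow (\<open>invariant_form_Poisson.anti_pre_Poisson\<close>). Some of
  them are the Poisson identities read through \<open>\<omega>\<close>. The others come from evaluating one expression
  in four arguments in two ways by means of the vanishing cyclic sums, which shows that twice the
  desired quantity is zero; here the characteristic must not be two. So (b) is equivalent to (c).

  For (d), pair a Poisson identity in three homogeneous elements of \<open>W\<close> with a fourth one. If at least
  three of the four come from the same summand, the resulting scalar identity follows from the
  identities of that summand. There remain eight scalar identities in \<open>x\<close>, \<open>y\<close> from \<open>A\<close> and \<open>a\<close>, \<open>b\<close> from the dual
  (\<open>Poisson_iff_mixed_identities\<close>), and each of them is one of the eight equations of a
  bialgebra, evaluated on the tensor product of \<open>a\<close> and \<open>b\<close>: associativity gives the first two,
  the Jacobi identity the next two, and the Leibniz rule the last four.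
\<close>

section \<open>Bilinear products on a subspace\<close>

context algebra_on
begin

lemma carrier_closed:
  "0 \<in> V"
  "x \<in> V \<Longrightarrow> y \<in> V \<Longrightarrow> x + y \<in> V"
  "x \<in> V \<Longrightarrow> y \<in> V \<Longrightarrow> x - y \<in> V"
  "x \<in> V \<Longrightarrow> - x \<in> V"
  "x \<in> V \<Longrightarrow> s c x \<in> V"
  using carrier_subspace
  by (auto intro: subspace_0 subspace_add subspace_diff subspace_neg subspace_scale)

lemma mult_in: "x \<in> V \<Longrightarrow> y \<in> V \<Longrightarrow> mult x y \<in> V"
  using mult_bilinear by (simp add: bilinear_map_def)

lemma mult_add:
  "x \<in> V \<Longrightarrow> x' \<in> V \<Longrightarrow> y \<in> V \<Longrightarrow> mult (x + x') y = mult x y + mult x' y"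
  "x \<in> V \<Longrightarrow> y \<in> V \<Longrightarrow> y' \<in> V \<Longrightarrow> mult x (y + y') = mult x y + mult x y'"
  using mult_bilinear by (simp_all add: bilinear_map_def)

lemma mult_scale:
  "x \<in> V \<Longrightarrow> y \<in> V \<Longrightarrow> mult (s c x) y = s c (mult x y)"
  "x \<in> V \<Longrightarrow> y \<in> V \<Longrightarrow> mult x (s c y) = s c (mult x y)"
  using mult_bilinear by (simp_all add: bilinear_map_def)

lemma mult_diff:
  "x \<in> V \<Longrightarrow> x' \<in> V \<Longrightarrow> y \<in> V \<Longrightarrow> mult (x - x') y = mult x y - mult x' y"
  "x \<in> V \<Longrightarrow> y \<in> V \<Longrightarrow> y' \<in> V \<Longrightarrow> mult x (y - y') = mult x y - mult x y'"
  using mult_add(1)[of "x - x'" x' y] mult_add(2)[of x "y - y'" y']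
  by (simp_all add: carrier_closed)

lemma mult_zero:
  "y \<in> V \<Longrightarrow> mult 0 y = 0"
  "x \<in> V \<Longrightarrow> mult x 0 = 0"
  using mult_diff(1)[of 0 0 y] mult_diff(2)[of x 0 0] by (simp_all add: carrier_closed)

lemma mult_minus:
  "x \<in> V \<Longrightarrow> y \<in> V \<Longrightarrow> mult (- x) y = - mult x y"
  "x \<in> V \<Longrightarrow> y \<in> V \<Longrightarrow> mult x (- y) = - mult x y"
  using mult_diff(1)[of 0 x y] mult_diff(2)[of x 0 y]
  by (simp_all add: carrier_closed mult_zero)

lemma algebra_on_anticommutator: "algebra_on s V (anticommutator mult)"
  by unfold_locales
    (auto simp: bilinear_map_def anticommutator_def carrier_subspace carrier_closed mult_in mult_add
      mult_scale scale_right_distrib algebra_simps)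

lemma algebra_on_commutator: "algebra_on s V (commutator mult)"
  by unfold_locales
    (auto simp: bilinear_map_def commutator_def carrier_subspace carrier_closed mult_in mult_add
      mult_scale scale_right_diff_distrib algebra_simps)

end


section \<open>The sub-adjacent Poisson algebra\<close>

context anti_pre_Poisson_algebra
begin

lemma ast_algebra: "algebra_on s V (\<ast>)" ..
lemma circ_algebra: "algebra_on s V (\<odot>)" ..

lemmas ast_in = algebra_on.mult_in[OF ast_algebra]
  and ast_add = algebra_on.mult_add[OF ast_algebra]
  and ast_diff = algebra_on.mult_diff[OF ast_algebra]
  and circ_in = algebra_on.mult_in[OF circ_algebra]
  and circ_add = algebra_on.mult_add[OF circ_algebra]
  and circ_diff = algebra_on.mult_diff[OF circ_algebra]

text \<open>
  By the anti-Zinbiel identities \<open>x \<ast> (y \<ast> z)\<close> is symmetric in all three arguments, and both bracketings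
  of \<open>x \<star> y \<star> z\<close> reduce to it.
\<close>

lemma sub_adjacent_assoc:
  assumes "x \<in> V" "y \<in> V" "z \<in> V"
  shows "anticommutator (\<ast>) (anticommutator (\<ast>) x y) z
    = anticommutator (\<ast>) x (anticommutator (\<ast>) y z)"
proof -
  have *: "anticommutator (\<ast>) (anticommutator (\<ast>) x y) z = x \<ast> (y \<ast> z)"
    if "x \<in> V" "y \<in> V" "z \<in> V" for x y z
  proof -
    have 1: "(x \<ast> y + y \<ast> x) \<ast> z = - (x \<ast> (y \<ast> z))"
      using az1[OF that] by simp
    have 2: "z \<ast> (x \<ast> y) = x \<ast> (y \<ast> z)" "z \<ast> (y \<ast> x) = x \<ast> (y \<ast> z)"
      using that by (metis az3 az4)+
    show ?thesis
      by (simp add: anticommutator_def 1 ast_add ast_in that 2)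
  qed
  have "anticommutator (\<ast>) x (anticommutator (\<ast>) y z) = y \<ast> (z \<ast> x)"
    using *[of y z x] assms by (simp add: anticommutator_def add.commute)
  then show ?thesis
    using * assms by (metis az3 az4)
qed

text \<open>
  The double commutators split into the cyclic sum of the \<open>[x, y] \<odot> z\<close> and, by the first anti-pre-Lie
  identity, the same cyclic sum again; the second anti-pre-Lie identity makes it zero.
\<close>

lemma sub_adjacent_jacobi:
  assumes "x \<in> V" "y \<in> V" "z \<in> V"
  shows "commutator (\<odot>) (commutator (\<odot>) x y) z + commutator (\<odot>) (commutator (\<odot>) y z) x
    + commutator (\<odot>) (commutator (\<odot>) z x) y = 0"
proof -
  have "commutator (\<odot>) (commutator (\<odot>) x y) z + commutator (\<odot>) (commutator (\<odot>) y z) x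
      + commutator (\<odot>) (commutator (\<odot>) z x) y
    = (commutator (\<odot>) x y \<odot> z + commutator (\<odot>) y z \<odot> x + commutator (\<odot>) z x \<odot> y)
      - (x \<odot> (y \<odot> z) - y \<odot> (x \<odot> z)) - (y \<odot> (z \<odot> x) - z \<odot> (y \<odot> x))
      - (z \<odot> (x \<odot> y) - x \<odot> (z \<odot> y))"
    by (simp add: commutator_def circ_diff circ_in assms)
  also have "\<dots> = 0 - (commutator (\<odot>) y x \<odot> z) - (commutator (\<odot>) z y \<odot> x) - (commutator (\<odot>) x z \<odot> y)"
    using apl1 apl2 assms by simp
  also have "\<dots> = commutator (\<odot>) x y \<odot> z + commutator (\<odot>) y z \<odot> x + commutator (\<odot>) z x \<odot> y"
    by (simp add: commutator_def circ_diff circ_in assms)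
  finally show ?thesis using apl2 assms by simp
qed

text \<open>
  Both sides equal \<open>x \<ast> (z \<odot> y) + y \<ast> (z \<odot> x)\<close>.
\<close>

lemma sub_adjacent_leibniz:
  assumes "x \<in> V" "y \<in> V" "z \<in> V"
  shows "commutator (\<odot>) z (anticommutator (\<ast>) x y)
    = anticommutator (\<ast>) (commutator (\<odot>) z x) y + anticommutator (\<ast>) x (commutator (\<odot>) z y)"
proof -
  have 3: "z \<odot> (x \<ast> y) + z \<odot> (y \<ast> x) = x \<ast> (z \<odot> y) + y \<ast> (z \<odot> x) - x \<ast> (y \<odot> z) - y \<ast> (x \<odot> z)"
    using app3[OF assms] by (simp add: circ_add ast_in assms algebra_simps)
  have 2: "(x \<ast> y) \<odot> z + (y \<ast> x) \<odot> z = - (x \<ast> (y \<odot> z)) - y \<ast> (x \<odot> z)"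
    using app2[OF assms] by (simp add: circ_add ast_in assms)
  have 1: "(z \<odot> x) \<ast> y - (x \<odot> z) \<ast> y = x \<ast> (z \<odot> y) - z \<odot> (x \<ast> y)"
    "(z \<odot> y) \<ast> x - (y \<odot> z) \<ast> x = y \<ast> (z \<odot> x) - z \<odot> (y \<ast> x)"
    using app1[of z x y] app1[of z y x] by (simp_all add: ast_diff circ_in assms)
  have "commutator (\<odot>) z (anticommutator (\<ast>) x y)
      = (z \<odot> (x \<ast> y) + z \<odot> (y \<ast> x)) - ((x \<ast> y) \<odot> z + (y \<ast> x) \<odot> z)"
    by (simp add: commutator_def anticommutator_def circ_add ast_in assms)
  also have "\<dots> = x \<ast> (z \<odot> y) + y \<ast> (z \<odot> x)"
    unfolding 2 3 by simp
  finally have L: "commutator (\<odot>) z (anticommutator (\<ast>) x y) = \<dots>" .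
  have "anticommutator (\<ast>) (commutator (\<odot>) z x) y + anticommutator (\<ast>) x (commutator (\<odot>) z y)
      = ((z \<odot> x) \<ast> y - (x \<odot> z) \<ast> y) + ((z \<odot> y) \<ast> x - (y \<odot> z) \<ast> x)
        + (y \<ast> (z \<odot> x) - y \<ast> (x \<odot> z) + x \<ast> (z \<odot> y) - x \<ast> (y \<odot> z))"
    by (simp add: commutator_def anticommutator_def ast_diff circ_in assms algebra_simps)
  also have "\<dots> = (x \<ast> (z \<odot> y) + y \<ast> (z \<odot> x) - x \<ast> (y \<odot> z) - y \<ast> (x \<odot> z))
      - (z \<odot> (x \<ast> y) + z \<odot> (y \<ast> x)) + (x \<ast> (z \<odot> y) + y \<ast> (z \<odot> x))"
    unfolding 1 by (simp add: algebra_simps)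
  also have "\<dots> = x \<ast> (z \<odot> y) + y \<ast> (z \<odot> x)"
    unfolding 3 by simp
  finally show ?thesis using L by simp
qed

theorem sub_adjacent_Poisson:
  "Poisson_algebra s V (anticommutator (\<ast>)) (commutator (\<odot>))"
proof (intro Poisson_algebra.intro Poisson_algebra_axioms.intro)
  show "algebra_on s V (anticommutator (\<ast>))"
    by (rule algebra_on.algebra_on_anticommutator[OF ast_algebra])
  show "algebra_on s V (commutator (\<odot>))"
    by (rule algebra_on.algebra_on_commutator[OF circ_algebra])
qed (simp_all add: sub_adjacent_assoc sub_adjacent_jacobi sub_adjacent_leibniz,
  simp_all add: anticommutator_def commutator_def add.commute)

end


section \<open>Products with an invariant symmetric form\<close>

text \<open>
  The data of a quadratic anti-pre-Poisson algebra without the identities of the algebra. The point is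
  that the form translates identities between \<open>\<ast>\<close> and \<open>\<odot>\<close> into identities between \<open>\<star>\<close> and the bracket.
\<close>

locale invariant_form = ast: algebra_on s V ast + circ: algebra_on s V circ
  for s :: "'k::field \<Rightarrow> 'v::ab_group_add \<Rightarrow> 'v" and V
    and ast :: "'v \<Rightarrow> 'v \<Rightarrow> 'v" (infixl "\<ast>" 70)
    and circ :: "'v \<Rightarrow> 'v \<Rightarrow> 'v" (infixl "\<odot>" 70) +
  fixes \<omega> :: "'v \<Rightarrow> 'v \<Rightarrow> 'k"
  assumes form_bilinear: "bilinear_map s V s V (*) UNIV \<omega>"
    and form_symmetric: "\<lbrakk>x \<in> V; y \<in> V\<rbrakk> \<Longrightarrow> \<omega> x y = \<omega> y x"
    and form_nondegenerate: "\<lbrakk>x \<in> V; \<And>y. y \<in> V \<Longrightarrow> \<omega> x y = 0\<rbrakk> \<Longrightarrow> x = 0"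
    and form_ast: "\<lbrakk>x \<in> V; y \<in> V; z \<in> V\<rbrakk> \<Longrightarrow> \<omega> (x \<ast> y) z = - \<omega> y (anticommutator (\<ast>) x z)"
    and form_circ: "\<lbrakk>x \<in> V; y \<in> V; z \<in> V\<rbrakk> \<Longrightarrow> \<omega> (x \<odot> y) z = \<omega> y (commutator (\<odot>) x z)"
begin

abbreviation star (infixl "\<star>" 70) where "x \<star> y \<equiv> anticommutator (\<ast>) x y"
abbreviation br ("\<lbrakk>_,/ _\<rbrakk>") where "\<lbrakk>x, y\<rbrakk> \<equiv> commutator (\<odot>) x y"

sublocale star: algebra_on s V "anticommutator (\<ast>)"
  by (rule ast.algebra_on_anticommutator)

sublocale br: algebra_on s V "commutator (\<odot>)"
  by (rule circ.algebra_on_commutator)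

lemmas closed = ast.carrier_closed ast.mult_in circ.mult_in star.mult_in br.mult_in

lemma form_add:
  "x \<in> V \<Longrightarrow> x' \<in> V \<Longrightarrow> y \<in> V \<Longrightarrow> \<omega> (x + x') y = \<omega> x y + \<omega> x' y"
  "x \<in> V \<Longrightarrow> y \<in> V \<Longrightarrow> y' \<in> V \<Longrightarrow> \<omega> x (y + y') = \<omega> x y + \<omega> x y'"
  using form_bilinear by (simp_all add: bilinear_map_def)

lemma form_diff:
  "x \<in> V \<Longrightarrow> x' \<in> V \<Longrightarrow> y \<in> V \<Longrightarrow> \<omega> (x - x') y = \<omega> x y - \<omega> x' y"
  "x \<in> V \<Longrightarrow> y \<in> V \<Longrightarrow> y' \<in> V \<Longrightarrow> \<omega> x (y - y') = \<omega> x y - \<omega> x y'"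
  using form_add(1)[of "x - x'" x' y] form_add(2)[of x "y - y'" y']
  by (simp_all add: closed)

lemma form_zero:
  "y \<in> V \<Longrightarrow> \<omega> 0 y = 0"
  "x \<in> V \<Longrightarrow> \<omega> x 0 = 0"
  using form_diff(1)[of 0 0 y] form_diff(2)[of x 0 0] by (simp_all add: closed)

lemma form_minus:
  "x \<in> V \<Longrightarrow> y \<in> V \<Longrightarrow> \<omega> (- x) y = - \<omega> x y"
  "x \<in> V \<Longrightarrow> y \<in> V \<Longrightarrow> \<omega> x (- y) = - \<omega> x y"
  using form_diff(1)[of 0 x y] form_diff(2)[of x 0 y] by (simp_all add: closed form_zero)

lemma form_eqI:
  assumes "u \<in> V" "v \<in> V" "\<And>t. t \<in> V \<Longrightarrow> \<omega> u t = \<omega> v t"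
  shows "u = v"
  using form_nondegenerate[of "u - v"] assms by (simp add: closed form_diff)

lemma star_commute: "x \<star> y = y \<star> x"
  by (simp add: anticommutator_def add.commute)

lemma br_skew: "\<lbrakk>x, y\<rbrakk> = - \<lbrakk>y, x\<rbrakk>"
  by (simp add: commutator_def)

text \<open>
  This and the next lemma say that \<open>\<omega>\<close> is a symmetric 2-cocycle for \<open>\<star>\<close> and for the bracket. They
  result from expanding \<open>\<star>\<close> or the bracket in the first term and moving its first factor across the form.
\<close>

lemma form_star_cyclic:
  assumes "x \<in> V" "y \<in> V" "z \<in> V"
  shows "\<omega> (x \<star> y) z + \<omega> (y \<star> z) x + \<omega> (z \<star> x) y = 0"
proof -
  have "\<omega> (x \<star> y) z = - \<omega> y (x \<star> z) - \<omega> x (y \<star> z)"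
    using assms by (simp add: anticommutator_def[of _ x y] form_add closed form_ast)
  then show ?thesis
    using assms by (simp add: form_symmetric closed star_commute[of z x])
qed

lemma form_br_cyclic:
  assumes "x \<in> V" "y \<in> V" "z \<in> V"
  shows "\<omega> \<lbrakk>x, y\<rbrakk> z + \<omega> \<lbrakk>y, z\<rbrakk> x + \<omega> \<lbrakk>z, x\<rbrakk> y = 0"
proof -
  have "\<omega> \<lbrakk>x, y\<rbrakk> z = \<omega> y \<lbrakk>x, z\<rbrakk> - \<omega> x \<lbrakk>y, z\<rbrakk>"
    using assms by (simp add: commutator_def[of _ x y] form_diff closed form_circ)
  then show ?thesis
    using assms by (simp add: form_symmetric[of y] form_symmetric[of x] form_minus closed br_skew[of z x])
qed

text \<open>
  The Jacobi identity as a statement about the bracketing operators of \<open>x\<close> and \<open>y\<close> acting on \<open>z\<close>. This form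
  is adapted to \<open>x\<close>, \<open>y\<close> in an algebra and \<open>z\<close> in its dual, where the operators can be transposed.
\<close>

lemma jacobi_iff_derivation:
  assumes "x \<in> V" "y \<in> V" "z \<in> V"
  shows "\<lbrakk>\<lbrakk>x, y\<rbrakk>, z\<rbrakk> + \<lbrakk>\<lbrakk>y, z\<rbrakk>, x\<rbrakk> + \<lbrakk>\<lbrakk>z, x\<rbrakk>, y\<rbrakk> = 0
    \<longleftrightarrow> \<lbrakk>\<lbrakk>x, y\<rbrakk>, z\<rbrakk> = \<lbrakk>x, \<lbrakk>y, z\<rbrakk>\<rbrakk> - \<lbrakk>y, \<lbrakk>x, z\<rbrakk>\<rbrakk>"
proof -
  have 1: "\<lbrakk>\<lbrakk>z, x\<rbrakk>, y\<rbrakk> = \<lbrakk>y, \<lbrakk>x, z\<rbrakk>\<rbrakk>"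
    using assms by (simp add: br_skew[of z x] br_skew[of _ y] br.mult_minus closed)
  have 2: "\<lbrakk>\<lbrakk>y, z\<rbrakk>, x\<rbrakk> = - \<lbrakk>x, \<lbrakk>y, z\<rbrakk>\<rbrakk>"
    by (rule br_skew)
  show ?thesis unfolding 1 2 by (simp add: algebra_simps add_eq_0_iff2)
qed

end

lemma double_zero_imp_zero:
  fixes p :: "'k::field"
  assumes "(2::'k) \<noteq> 0" and "p + p = 0"
  shows "p = 0"
  using assms by (metis mult_2 mult_eq_0_iff)

locale invariant_form_Poisson =
  invariant_form s V ast circ \<omega> + P: Poisson_algebra s V "anticommutator ast" "commutator circ"
  for s :: "'k::field \<Rightarrow> 'v::ab_group_add \<Rightarrow> 'v" and V
    and ast (infixl "\<ast>" 70) and circ (infixl "\<odot>" 70) and \<omega> +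
  assumes two_nonzero: "(2::'k) \<noteq> 0"
begin

lemma star_left_commute:
  assumes "x \<in> V" "y \<in> V" "z \<in> V"
  shows "x \<star> (y \<star> z) = y \<star> (x \<star> z)"
  using assms P.star_assoc[of x y z] P.star_assoc[of y x z] star_commute[of x y] by simp

lemmas star_ac = P.star_assoc star_commute star_left_commute

text \<open>
  Let \<open>q x\<close> be \<open>\<omega> x\<close> of the product of the other three elements. The cyclic identity gives
  \<open>q x + q y = - \<omega> (x \<star> y) (z \<star> w)\<close>, which is also \<open>q z + q w\<close>. Comparing two of the three ways to
  split the four elements into pairs gives \<open>2 (q x - q w) = 0\<close>.
\<close>

lemma form_triple_swap:
  assumes V: "x \<in> V" "y \<in> V" "z \<in> V" "w \<in> V"
  shows "\<omega> x (y \<star> (z \<star> w)) = \<omega> w (y \<star> (z \<star> x))"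
proof -
  have cyc: "\<omega> a (b \<star> (c \<star> d)) + \<omega> b (a \<star> (c \<star> d)) = - \<omega> (a \<star> b) (c \<star> d)"
    if "a \<in> V" "b \<in> V" "c \<in> V" "d \<in> V" for a b c d
    using form_star_cyclic[of a b "c \<star> d"] that
    by (simp add: form_symmetric[of a] form_symmetric[of b] closed star_commute[of "c \<star> d"]
        eq_neg_iff_add_eq_0 add.assoc add.left_commute add.commute)
  have "\<omega> x (y \<star> (z \<star> w)) + \<omega> y (x \<star> (z \<star> w)) = \<omega> z (y \<star> (x \<star> w)) + \<omega> w (y \<star> (z \<star> x))"
    using cyc[of x y z w] cyc[of z w x y] V
    by (simp add: form_symmetric[of "x \<star> y"] closed star_ac)
  moreover have "\<omega> x (y \<star> (z \<star> w)) + \<omega> z (y \<star> (x \<star> w)) = \<omega> y (x \<star> (z \<star> w)) + \<omega> w (y \<star> (z \<star> x))"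
    using cyc[of x z y w] cyc[of y w x z] V
    by (simp add: form_symmetric[of "x \<star> z"] closed star_ac)
  ultimately have "(\<omega> x (y \<star> (z \<star> w)) - \<omega> w (y \<star> (z \<star> x))) + (\<omega> x (y \<star> (z \<star> w)) - \<omega> w (y \<star> (z \<star> x))) = 0"
    by algebra
  then show ?thesis
    using double_zero_imp_zero[OF two_nonzero] by fastforce
qed

lemma br_derivation:
  assumes "x \<in> V" "y \<in> V" "z \<in> V"
  shows "\<lbrakk>x, \<lbrakk>y, z\<rbrakk>\<rbrakk> = \<lbrakk>\<lbrakk>x, y\<rbrakk>, z\<rbrakk> + \<lbrakk>y, \<lbrakk>x, z\<rbrakk>\<rbrakk>"
  using jacobi_iff_derivation[OF assms] P.jacobi[OF assms] by simp

text \<open>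
  Let \<open>A\<close> be the sum of \<open>\<omega> \<lbrakk>x, y\<rbrakk> \<lbrakk>z, w\<rbrakk>\<close> over the three ways to split the four elements into pairs. By
  the symmetry of \<open>\<omega>\<close>, the cyclic identity can be used to break up either of the two brackets in each
  summand. With the Jacobi identity, one choice gives \<open>A = S\<close> for the sum \<open>S\<close> in question and the other
  gives \<open>A = - S\<close>.
\<close>

lemma form_br_br_cyclic:
  assumes V: "x \<in> V" "y \<in> V" "z \<in> V" "w \<in> V"
  shows "\<omega> z \<lbrakk>\<lbrakk>x, y\<rbrakk>, w\<rbrakk> + \<omega> x \<lbrakk>\<lbrakk>y, z\<rbrakk>, w\<rbrakk> + \<omega> y \<lbrakk>\<lbrakk>z, x\<rbrakk>, w\<rbrakk> = 0"
proof -
  have cyc: "\<omega> \<lbrakk>a, b\<rbrakk> \<lbrakk>c, d\<rbrakk> = \<omega> a \<lbrakk>\<lbrakk>c, d\<rbrakk>, b\<rbrakk> - \<omega> b \<lbrakk>\<lbrakk>c, d\<rbrakk>, a\<rbrakk>"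
    if "a \<in> V" "b \<in> V" "c \<in> V" "d \<in> V" for a b c d
    using form_br_cyclic[of a b "\<lbrakk>c, d\<rbrakk>"] that
    by (simp add: form_symmetric[of a] form_symmetric[of b] closed br_skew[of b "\<lbrakk>c, d\<rbrakk>"] form_minus
        algebra_simps eq_neg_iff_add_eq_0)
  have der: "\<omega> a \<lbrakk>\<lbrakk>b, c\<rbrakk>, d\<rbrakk> + \<omega> a \<lbrakk>\<lbrakk>c, d\<rbrakk>, b\<rbrakk> + \<omega> a \<lbrakk>\<lbrakk>d, b\<rbrakk>, c\<rbrakk> = 0"
    if "a \<in> V" "b \<in> V" "c \<in> V" "d \<in> V" for a b c d
    using that P.jacobi[of b c d] by (simp add: closed form_zero flip: form_add)
  have skew: "\<omega> a \<lbrakk>\<lbrakk>b, c\<rbrakk>, d\<rbrakk> = - \<omega> a \<lbrakk>\<lbrakk>c, b\<rbrakk>, d\<rbrakk>" if "a \<in> V" "b \<in> V" "c \<in> V" "d \<in> V" for a b c d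
    using that by (simp add: br_skew[of b c] br.mult_minus form_minus closed)
  have der': "\<omega> a \<lbrakk>\<lbrakk>c, d\<rbrakk>, b\<rbrakk> - \<omega> a \<lbrakk>\<lbrakk>b, d\<rbrakk>, c\<rbrakk> = - \<omega> a \<lbrakk>\<lbrakk>b, c\<rbrakk>, d\<rbrakk>"
    if "a \<in> V" "b \<in> V" "c \<in> V" "d \<in> V" for a b c d
    using der[OF that] skew[OF that(1,2,4,3)] by algebra
  define S where "S = \<omega> z \<lbrakk>\<lbrakk>x, y\<rbrakk>, w\<rbrakk> + \<omega> x \<lbrakk>\<lbrakk>y, z\<rbrakk>, w\<rbrakk> + \<omega> y \<lbrakk>\<lbrakk>z, x\<rbrakk>, w\<rbrakk>"
  define A where "A = \<omega> \<lbrakk>x, y\<rbrakk> \<lbrakk>z, w\<rbrakk> + \<omega> \<lbrakk>y, z\<rbrakk> \<lbrakk>x, w\<rbrakk> + \<omega> \<lbrakk>z, x\<rbrakk> \<lbrakk>y, w\<rbrakk>"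
  have "A = (\<omega> x \<lbrakk>\<lbrakk>z, w\<rbrakk>, y\<rbrakk> - \<omega> x \<lbrakk>\<lbrakk>y, w\<rbrakk>, z\<rbrakk>) + (\<omega> y \<lbrakk>\<lbrakk>x, w\<rbrakk>, z\<rbrakk> - \<omega> y \<lbrakk>\<lbrakk>z, w\<rbrakk>, x\<rbrakk>)
      + (\<omega> z \<lbrakk>\<lbrakk>y, w\<rbrakk>, x\<rbrakk> - \<omega> z \<lbrakk>\<lbrakk>x, w\<rbrakk>, y\<rbrakk>)"
    unfolding A_def cyc[OF V(1,2,3,4)] cyc[OF V(2,3,1,4)] cyc[OF V(3,1,2,4)] by simp
  also have "\<dots> = - S"
    unfolding S_def der'[OF V(1,2,3,4)] der'[OF V(2,3,1,4)] der'[OF V(3,1,2,4)] by simp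
  finally have "A = - S" .
  have "A = \<omega> \<lbrakk>z, w\<rbrakk> \<lbrakk>x, y\<rbrakk> + \<omega> \<lbrakk>x, w\<rbrakk> \<lbrakk>y, z\<rbrakk> + \<omega> \<lbrakk>y, w\<rbrakk> \<lbrakk>z, x\<rbrakk>"
    unfolding A_def using V by (simp add: form_symmetric closed)
  also have "\<dots> = S - (\<omega> w \<lbrakk>\<lbrakk>x, y\<rbrakk>, z\<rbrakk> + \<omega> w \<lbrakk>\<lbrakk>y, z\<rbrakk>, x\<rbrakk> + \<omega> w \<lbrakk>\<lbrakk>z, x\<rbrakk>, y\<rbrakk>)"
    unfolding S_def cyc[OF V(3,4,1,2)] cyc[OF V(1,4,2,3)] cyc[OF V(2,4,3,1)] by simp
  also have "\<dots> = S"
    using der[OF V(4,1,2,3)] by simp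
  finally have "S + S = 0"
    using \<open>A = - S\<close> by (simp add: eq_neg_iff_add_eq_0)
  then show ?thesis
    using double_zero_imp_zero[OF two_nonzero] unfolding S_def by blast
qed

text \<open>
  Each summand can be broken up at the star product or at the bracket, in the latter case with the help
  of the Leibniz rule. The first way gives the negative of the result of the second.
\<close>

lemma form_star_br_sum:
  assumes V: "x \<in> V" "y \<in> V" "z \<in> V" "w \<in> V"
  shows "\<omega> (x \<star> y) \<lbrakk>z, w\<rbrakk> + \<omega> (x \<star> w) \<lbrakk>z, y\<rbrakk> + \<omega> (y \<star> w) \<lbrakk>z, x\<rbrakk> = 0"
proof -
  define F where "F = \<omega> (x \<star> y) \<lbrakk>z, w\<rbrakk> + \<omega> (x \<star> w) \<lbrakk>z, y\<rbrakk> + \<omega> (y \<star> w) \<lbrakk>z, x\<rbrakk>"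
  have st: "\<omega> (a \<star> b) \<lbrakk>c, d\<rbrakk> = - \<omega> a (b \<star> \<lbrakk>c, d\<rbrakk>) - \<omega> b (a \<star> \<lbrakk>c, d\<rbrakk>)"
    if "a \<in> V" "b \<in> V" "c \<in> V" "d \<in> V" for a b c d
    using form_star_cyclic[of a b "\<lbrakk>c, d\<rbrakk>"] that
    by (simp add: form_symmetric[of a] form_symmetric[of b] closed star_commute[of "\<lbrakk>c, d\<rbrakk>"])
      algebra
  have br: "\<omega> (a \<star> b) \<lbrakk>c, d\<rbrakk> = \<omega> c (b \<star> \<lbrakk>a, d\<rbrakk>) + \<omega> c (a \<star> \<lbrakk>b, d\<rbrakk>) - \<omega> d (b \<star> \<lbrakk>a, c\<rbrakk>) - \<omega> d (a \<star> \<lbrakk>b, c\<rbrakk>)"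
    if "a \<in> V" "b \<in> V" "c \<in> V" "d \<in> V" for a b c d
  proof -
    have leib: "\<lbrakk>e, a \<star> b\<rbrakk> = b \<star> \<lbrakk>e, a\<rbrakk> + a \<star> \<lbrakk>e, b\<rbrakk>" if "e \<in> V" for e
      using that \<open>a \<in> V\<close> \<open>b \<in> V\<close> by (simp add: P.leibniz star_commute[of b])
    have "\<omega> (a \<star> b) \<lbrakk>c, d\<rbrakk> = - \<omega> \<lbrakk>d, a \<star> b\<rbrakk> c + \<omega> \<lbrakk>c, a \<star> b\<rbrakk> d"
      using form_br_cyclic[of c d "a \<star> b"] that
      by (simp add: form_symmetric[of "a \<star> b"] closed br_skew[of "a \<star> b" c] form_minus
          algebra_simps)
    also have "\<dots> = - \<omega> c (b \<star> \<lbrakk>d, a\<rbrakk>) - \<omega> c (a \<star> \<lbrakk>d, b\<rbrakk>) + \<omega> d (b \<star> \<lbrakk>c, a\<rbrakk>) + \<omega> d (a \<star> \<lbrakk>c, b\<rbrakk>)"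
      using that by (simp add: leib form_add closed form_symmetric[of c] form_symmetric[of d])
    finally show ?thesis
      using that by (simp add: br_skew[of d a] br_skew[of d b] br_skew[of c a] br_skew[of c b] star.mult_minus form_minus closed)
  qed
  have sk: "\<omega> a (b \<star> \<lbrakk>c, d\<rbrakk>) = - \<omega> a (b \<star> \<lbrakk>d, c\<rbrakk>)"
    if "a \<in> V" "b \<in> V" "c \<in> V" "d \<in> V" for a b c d
    using that by (simp add: br_skew[of c d] star.mult_minus form_minus closed)
  define G where "G = \<omega> x (y \<star> \<lbrakk>z, w\<rbrakk>) + \<omega> y (x \<star> \<lbrakk>z, w\<rbrakk>) + \<omega> x (w \<star> \<lbrakk>z, y\<rbrakk>)
    + \<omega> w (x \<star> \<lbrakk>z, y\<rbrakk>) + \<omega> y (w \<star> \<lbrakk>z, x\<rbrakk>) + \<omega> w (y \<star> \<lbrakk>z, x\<rbrakk>)"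
  have "F = - G"
    unfolding F_def G_def st[OF V(1,2,3,4)] st[OF V(1,4,3,2)] st[OF V(2,4,3,1)] by simp
  moreover have "F = G"
    unfolding F_def G_def br[OF V(1,2,3,4)] br[OF V(1,4,3,2)] br[OF V(2,4,3,1)]
      sk[OF V(3,2,1,4)] sk[OF V(3,1,2,4)] sk[OF V(3,4,1,2)]
      sk[OF V(4,2,1,3)] sk[OF V(4,1,2,3)] sk[OF V(2,4,1,3)] sk[OF V(2,1,4,3)]
      sk[OF V(1,4,2,3)] sk[OF V(1,2,4,3)]
    by simp
  ultimately have "F + F = 0" by simp
  then show ?thesis
    using double_zero_imp_zero[OF two_nonzero] unfolding F_def by blast
qed

text \<open>
  Under the form, \<open>x \<ast> (y \<ast> z)\<close> becomes \<open>\<omega> z (y \<star> x \<star> t)\<close>, which is symmetric in all its arguments.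
\<close>

lemma anti_zinbiel_laws:
  assumes V: "x \<in> V" "y \<in> V" "z \<in> V"
  shows "x \<ast> (y \<ast> z) = - ((x \<ast> y + y \<ast> x) \<ast> z)"
    "x \<ast> (y \<ast> z) = - ((y \<ast> z + z \<ast> y) \<ast> x)"
    "x \<ast> (y \<ast> z) = z \<ast> (y \<ast> x)"
    "z \<ast> (x \<ast> y) = x \<ast> (z \<ast> y)"
proof -
  have 2: "\<omega> (x \<ast> (y \<ast> z)) t = \<omega> z (y \<star> (x \<star> t))" if "t \<in> V" "x \<in> V" "y \<in> V" "z \<in> V" for t x y z
    using that by (simp add: form_ast closed)
  have 1: "\<omega> (- ((x \<star> y) \<ast> z)) t = \<omega> z (y \<star> (x \<star> t))" if "t \<in> V" "x \<in> V" "y \<in> V" "z \<in> V" for t x y z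
    using that P.star_assoc[of y x t] by (simp add: form_ast closed form_minus star_commute[of y x])
  have swap: "\<omega> z (y \<star> (x \<star> t)) = \<omega> x (y \<star> (z \<star> t))" if "t \<in> V" for t
    using that form_triple_swap[of z y t x] V by (simp add: P.star_commute)
  have lc: "y \<star> (x \<star> t) = x \<star> (y \<star> t)" if "x \<in> V" "y \<in> V" "t \<in> V" for x y t
    using that P.star_assoc P.star_commute by metis
  have "x \<ast> (y \<ast> z) = - ((x \<star> y) \<ast> z)"
    by (rule form_eqI) (simp_all add: closed V 1 2)
  moreover have "x \<ast> (y \<ast> z) = - ((y \<star> z) \<ast> x)"
    by (rule form_eqI) (simp_all add: closed V 1 2 swap lc[of y z])
  ultimately show "x \<ast> (y \<ast> z) = - ((x \<ast> y + y \<ast> x) \<ast> z)"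
    "x \<ast> (y \<ast> z) = - ((y \<ast> z + z \<ast> y) \<ast> x)"
    by (simp_all add: anticommutator_def)
  show "x \<ast> (y \<ast> z) = z \<ast> (y \<ast> x)"
    by (rule form_eqI) (simp_all add: closed V 2 swap)
  show "z \<ast> (x \<ast> y) = x \<ast> (z \<ast> y)"
    by (rule form_eqI) (simp_all add: closed V 2 lc[of x z])
qed

text \<open>
  Nondegeneracy allows an identity to be checked after pairing with an arbitrary \<open>t\<close>. Invariance then
  turns the first anti-pre-Lie identity into the Jacobi identity and the first two compatibility
  conditions into the Leibniz rule. The second anti-pre-Lie identity becomes \<open>form_br_br_cyclic\<close>, and
  the third compatibility condition becomes \<open>form_star_br_sum\<close>.
\<close>

theorem anti_pre_Poisson: "anti_pre_Poisson_algebra s V (\<ast>) (\<odot>)"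
proof (unfold_locales, goal_cases)
  case (1 x y z) then show ?case by (rule anti_zinbiel_laws)
next
  case (2 x y z) then show ?case by (rule anti_zinbiel_laws)
next
  case (3 x y z) then show ?case by (rule anti_zinbiel_laws)
next
  case (4 x y z) then show ?case by (rule anti_zinbiel_laws)
next
  case (5 x y z)
  show ?case
  proof (rule form_eqI)
    fix t assume "t \<in> V"
    with 5 have "\<omega> (x \<odot> (y \<odot> z) - y \<odot> (x \<odot> z)) t = \<omega> z (\<lbrakk>y, \<lbrakk>x, t\<rbrakk>\<rbrakk> - \<lbrakk>x, \<lbrakk>y, t\<rbrakk>\<rbrakk>)"
      by (simp add: form_diff form_circ closed)
    also have "\<dots> = \<omega> (\<lbrakk>y, x\<rbrakk> \<odot> z) t"
      using 5 \<open>t \<in> V\<close> by (simp add: br_derivation[of y x t] form_circ closed)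
    finally show "\<omega> (x \<odot> (y \<odot> z) - y \<odot> (x \<odot> z)) t = \<omega> (\<lbrakk>y, x\<rbrakk> \<odot> z) t" .
  qed (simp_all add: 5 closed)
next
  case (6 x y z)
  show ?case
  proof (rule form_eqI)
    fix t assume "t \<in> V"
    with 6 show "\<omega> (\<lbrakk>x, y\<rbrakk> \<odot> z + \<lbrakk>y, z\<rbrakk> \<odot> x + \<lbrakk>z, x\<rbrakk> \<odot> y) t = \<omega> 0 t"
      using form_br_br_cyclic[of x y z t] by (simp add: form_add form_zero form_circ closed)
  qed (simp_all add: 6 closed)
next
  case (7 x y z)
  show ?case
  proof (rule form_eqI)
    fix t assume "t \<in> V"
    with 7 have "\<omega> (y \<ast> (x \<odot> z) - x \<odot> (y \<ast> z)) t = \<omega> z (y \<star> \<lbrakk>x, t\<rbrakk> - \<lbrakk>x, y \<star> t\<rbrakk>)"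
      by (simp add: form_diff form_ast form_circ closed)
    also have "\<dots> = \<omega> (\<lbrakk>x, y\<rbrakk> \<ast> z) t"
      using 7 \<open>t \<in> V\<close> by (simp add: P.leibniz form_ast form_minus closed)
    finally show "\<omega> ((x \<odot> y - y \<odot> x) \<ast> z) t = \<omega> (y \<ast> (x \<odot> z) - x \<odot> (y \<ast> z)) t"
      by (simp add: commutator_def)
  qed (simp_all add: 7 closed)
next
  case (8 x y z)
  show ?case
  proof (rule form_eqI)
    fix t assume t: "t \<in> V"
    have "\<omega> (- (x \<ast> (y \<odot> z)) - y \<ast> (x \<odot> z)) t = \<omega> z (\<lbrakk>y, x \<star> t\<rbrakk> + \<lbrakk>x, y \<star> t\<rbrakk>)"
      using 8 t by (simp add: form_diff form_minus form_add form_ast form_circ closed)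
    also have "\<lbrakk>y, x \<star> t\<rbrakk> + \<lbrakk>x, y \<star> t\<rbrakk> = \<lbrakk>x \<star> y, t\<rbrakk>"
    proof -
      have "\<lbrakk>x \<star> y, t\<rbrakk> = - (\<lbrakk>t, x\<rbrakk> \<star> y + x \<star> \<lbrakk>t, y\<rbrakk>)"
        using 8 t by (simp add: br_skew[of "x \<star> y"] P.leibniz)
      also have "\<dots> = y \<star> \<lbrakk>x, t\<rbrakk> + x \<star> \<lbrakk>y, t\<rbrakk>"
        using 8 t by (simp add: br_skew[of t] star.mult_minus closed star_commute[of _ y])
      also have "\<dots> = \<lbrakk>y, x \<star> t\<rbrakk> + \<lbrakk>x, y \<star> t\<rbrakk>"
        using 8 t by (simp add: P.leibniz br_skew[of y x] star.mult_minus closed)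
      finally show ?thesis ..
    qed
    finally show "\<omega> ((x \<ast> y + y \<ast> x) \<odot> z) t = \<omega> (- (x \<ast> (y \<odot> z)) - y \<ast> (x \<odot> z)) t"
      using 8 t by (simp add: form_circ closed flip: anticommutator_def)
  qed (simp_all add: 8 closed)
next
  case (9 x y z)
  have "z \<odot> (x \<star> y) + x \<ast> \<lbrakk>y, z\<rbrakk> + y \<ast> \<lbrakk>x, z\<rbrakk> = 0"
  proof (rule form_eqI)
    fix t assume t: "t \<in> V"
    show "\<omega> (z \<odot> (x \<star> y) + x \<ast> \<lbrakk>y, z\<rbrakk> + y \<ast> \<lbrakk>x, z\<rbrakk>) t = \<omega> 0 t"
      using form_star_br_sum[of x y z t] 9 t
      by (simp add: form_add form_zero form_ast form_circ closed form_symmetric[of "\<lbrakk>_, _\<rbrakk>"]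
          br_skew[of _ z] form_minus)
  qed (simp_all add: 9 closed)
  then show ?case
    using 9 by (simp add: anticommutator_def commutator_def ast.mult_diff closed algebra_simps)
qed

end


section \<open>Forms with two complementary isotropic subalgebras\<close>

context invariant_form
begin

lemma form_star:
  assumes "x \<in> V" "u \<in> V" "z \<in> V"
  shows "\<omega> (x \<star> u) z = - \<omega> u (x \<ast> z)"
  using form_ast[of x z u] assms by (simp add: form_symmetric closed)

lemma form_br:
  assumes "x \<in> V" "u \<in> V" "z \<in> V"
  shows "\<omega> \<lbrakk>x, u\<rbrakk> z = \<omega> u (x \<odot> z)"
  using form_circ[of x z u] assms by (simp add: form_symmetric closed)

text \<open>
  Associativity, the Jacobi identity, and the two ways of placing \<open>a\<close> in the Leibniz rule, for two
  elements of \<open>P\<close> and one of \<open>Q\<close>, seen through the pairing with \<open>Q\<close>. The pairing with \<open>P\<close> is left out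
  because the identities of \<open>P\<close> take care of it, see \<open>polar_identities\<close>.
\<close>

definition mixed_identities where
  "mixed_identities P Q \<longleftrightarrow> (\<forall>x\<in>P. \<forall>y\<in>P. \<forall>a\<in>Q. \<forall>b\<in>Q.
    \<omega> ((x \<star> y) \<star> a) b = \<omega> (x \<star> (y \<star> a)) b \<and>
    \<omega> \<lbrakk>\<lbrakk>x, y\<rbrakk>, a\<rbrakk> b = \<omega> \<lbrakk>x, \<lbrakk>y, a\<rbrakk>\<rbrakk> b - \<omega> \<lbrakk>y, \<lbrakk>x, a\<rbrakk>\<rbrakk> b \<and>
    \<omega> \<lbrakk>a, x \<star> y\<rbrakk> b = \<omega> (\<lbrakk>a, x\<rbrakk> \<star> y) b + \<omega> (x \<star> \<lbrakk>a, y\<rbrakk>) b \<and>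
    \<omega> \<lbrakk>x, y \<star> a\<rbrakk> b = \<omega> (\<lbrakk>x, y\<rbrakk> \<star> a) b + \<omega> (y \<star> \<lbrakk>x, a\<rbrakk>) b)"

end

text \<open>
  The abstract form of a direct sum of an algebra and its dual. The summands \<open>P\<close> and \<open>Q\<close> play symmetric
  roles, so that each statement about two elements of \<open>P\<close> and one of \<open>Q\<close> also serves with the roles
  exchanged.
\<close>

locale polarised_invariant_form = invariant_form s V ast circ \<omega>
  for s :: "'k::field \<Rightarrow> 'v::ab_group_add \<Rightarrow> 'v" and V
    and ast (infixl "\<ast>" 70) and circ (infixl "\<odot>" 70) and \<omega> +
  fixes P Q :: "'v set"
  assumes P_algebra: "anti_pre_Poisson_algebra s P (\<ast>) (\<odot>)"
    and Q_algebra: "anti_pre_Poisson_algebra s Q (\<ast>) (\<odot>)"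
    and P_sub: "P \<subseteq> V" and Q_sub: "Q \<subseteq> V"
    and P_isotropic: "\<lbrakk>x \<in> P; y \<in> P\<rbrakk> \<Longrightarrow> \<omega> x y = 0"
    and Q_isotropic: "\<lbrakk>x \<in> Q; y \<in> Q\<rbrakk> \<Longrightarrow> \<omega> x y = 0"
    and decomposition: "v \<in> V \<Longrightarrow> \<exists>p\<in>P. \<exists>q\<in>Q. v = p + q"
begin

lemma swap: "polarised_invariant_form s V (\<ast>) (\<odot>) \<omega> Q P"
proof (intro polarised_invariant_form.intro polarised_invariant_form_axioms.intro)
  show "invariant_form s V (\<ast>) (\<odot>) \<omega>" ..
next
  fix v assume "v \<in> V"
  then obtain p q where "p \<in> P" "q \<in> Q" "v = p + q" using decomposition by blast
  then show "\<exists>p\<in>Q. \<exists>q\<in>P. v = p + q" using add.commute by blast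
qed (simp_all add: P_algebra Q_algebra P_sub Q_sub P_isotropic Q_isotropic)

lemma in_V: "x \<in> P \<Longrightarrow> x \<in> V" "x \<in> Q \<Longrightarrow> x \<in> V"
  using P_sub Q_sub by auto

lemma polar_eqI:
  assumes "u \<in> V" "v \<in> V" "\<And>z. z \<in> P \<Longrightarrow> \<omega> u z = \<omega> v z" "\<And>b. b \<in> Q \<Longrightarrow> \<omega> u b = \<omega> v b"
  shows "u = v"
proof (rule form_eqI)
  fix t assume "t \<in> V"
  then obtain p q where "p \<in> P" "q \<in> Q" "t = p + q" using decomposition by blast
  then show "\<omega> u t = \<omega> v t" using assms in_V by (simp add: form_add)
qed (use assms in auto)

text \<open>
  Paired with \<open>z\<close> from \<open>P\<close>, each identity can be moved entirely onto \<open>z\<close>, where it becomes an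
  identity of \<open>P\<close> in \<open>x\<close>, \<open>y\<close>, \<open>z\<close> paired with \<open>a\<close>. For example \<open>\<omega> (x \<star> (y \<star> a)) z = \<omega> a (y \<ast> (x \<ast> z))\<close> and
  \<open>\<omega> ((x \<star> y) \<star> a) z = - \<omega> a ((x \<star> y) \<ast> z)\<close> agree by the anti-Zinbiel identity.
\<close>

lemma polar_identities:
  assumes x: "x \<in> P" and y: "y \<in> P" and a: "a \<in> Q" and mixed: "mixed_identities P Q"
  shows "(x \<star> y) \<star> a = x \<star> (y \<star> a)"
    and "\<lbrakk>\<lbrakk>x, y\<rbrakk>, a\<rbrakk> = \<lbrakk>x, \<lbrakk>y, a\<rbrakk>\<rbrakk> - \<lbrakk>y, \<lbrakk>x, a\<rbrakk>\<rbrakk>"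
    and "\<lbrakk>a, x \<star> y\<rbrakk> = \<lbrakk>a, x\<rbrakk> \<star> y + x \<star> \<lbrakk>a, y\<rbrakk>"
    and "\<lbrakk>x, y \<star> a\<rbrakk> = \<lbrakk>x, y\<rbrakk> \<star> a + y \<star> \<lbrakk>x, a\<rbrakk>"
proof -
  interpret P: anti_pre_Poisson_algebra s P "(\<ast>)" "(\<odot>)" by (rule P_algebra)
  note V = in_V(1)[OF x] in_V(1)[OF y] in_V(2)[OF a]
  have mx: "\<omega> ((x \<star> y) \<star> a) b = \<omega> (x \<star> (y \<star> a)) b"
    "\<omega> \<lbrakk>\<lbrakk>x, y\<rbrakk>, a\<rbrakk> b = \<omega> \<lbrakk>x, \<lbrakk>y, a\<rbrakk>\<rbrakk> b - \<omega> \<lbrakk>y, \<lbrakk>x, a\<rbrakk>\<rbrakk> b"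
    "\<omega> \<lbrakk>a, x \<star> y\<rbrakk> b = \<omega> (\<lbrakk>a, x\<rbrakk> \<star> y) b + \<omega> (x \<star> \<lbrakk>a, y\<rbrakk>) b"
    "\<omega> \<lbrakk>x, y \<star> a\<rbrakk> b = \<omega> (\<lbrakk>x, y\<rbrakk> \<star> a) b + \<omega> (y \<star> \<lbrakk>x, a\<rbrakk>) b" if "b \<in> Q" for b
    using mixed x y a that unfolding mixed_identities_def by blast+
  have app1': "u \<ast> (v \<odot> z) - v \<odot> (u \<ast> z) = \<lbrakk>v, u\<rbrakk> \<ast> z" if "u \<in> P" "v \<in> P" "z \<in> P" for u v z
    using P.app1[of v u z] that by (simp add: commutator_def)
  have ast_star: "u \<ast> (v \<ast> z) = - ((u \<star> v) \<ast> z)" if "u \<in> P" "v \<in> P" "z \<in> P" for u v z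
    using P.az1[of u v z] that by (simp add: anticommutator_def)
  have star_circ: "(u \<star> v) \<odot> z = - (u \<ast> (v \<odot> z)) - v \<ast> (u \<odot> z)" if "u \<in> P" "v \<in> P" "z \<in> P" for u v z
    using P.app2[of u v z] that by (simp add: anticommutator_def)
  show "(x \<star> y) \<star> a = x \<star> (y \<star> a)"
  proof (rule polar_eqI)
    fix z assume z: "z \<in> P"
    have "\<omega> (x \<star> (y \<star> a)) z = \<omega> a (y \<ast> (x \<ast> z))"
      using V in_V(1)[OF z] by (simp add: form_star closed)
    also have "\<dots> = \<omega> ((x \<star> y) \<star> a) z"
      using V in_V(1)[OF z] by (simp add: ast_star[OF y x z] form_star closed form_minus star_commute[of y])
    finally show "\<omega> ((x \<star> y) \<star> a) z = \<omega> (x \<star> (y \<star> a)) z" ..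
  qed (simp_all add: V closed mx)
  show "\<lbrakk>\<lbrakk>x, y\<rbrakk>, a\<rbrakk> = \<lbrakk>x, \<lbrakk>y, a\<rbrakk>\<rbrakk> - \<lbrakk>y, \<lbrakk>x, a\<rbrakk>\<rbrakk>"
  proof (rule polar_eqI)
    fix z assume z: "z \<in> P"
    have "\<omega> (\<lbrakk>x, \<lbrakk>y, a\<rbrakk>\<rbrakk> - \<lbrakk>y, \<lbrakk>x, a\<rbrakk>\<rbrakk>) z = \<omega> a (y \<odot> (x \<odot> z) - x \<odot> (y \<odot> z))"
      using V in_V(1)[OF z] by (simp add: form_diff form_br closed)
    also have "\<dots> = \<omega> \<lbrakk>\<lbrakk>x, y\<rbrakk>, a\<rbrakk> z"
      using V in_V(1)[OF z] by (simp add: P.apl1[OF y x z] form_br closed)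
    finally show "\<omega> \<lbrakk>\<lbrakk>x, y\<rbrakk>, a\<rbrakk> z = \<omega> (\<lbrakk>x, \<lbrakk>y, a\<rbrakk>\<rbrakk> - \<lbrakk>y, \<lbrakk>x, a\<rbrakk>\<rbrakk>) z" ..
  qed (simp_all add: V in_V closed mx form_diff)
  show "\<lbrakk>a, x \<star> y\<rbrakk> = \<lbrakk>a, x\<rbrakk> \<star> y + x \<star> \<lbrakk>a, y\<rbrakk>"
  proof (rule polar_eqI)
    fix z assume z: "z \<in> P"
    have "\<omega> (\<lbrakk>a, x\<rbrakk> \<star> y + x \<star> \<lbrakk>a, y\<rbrakk>) z = \<omega> (y \<star> \<lbrakk>a, x\<rbrakk>) z + \<omega> (x \<star> \<lbrakk>a, y\<rbrakk>) z"
      using V in_V(1)[OF z] by (simp add: form_add closed star_commute[of _ y])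
    also have "\<dots> = \<omega> a (x \<odot> (y \<ast> z)) + \<omega> a (y \<odot> (x \<ast> z))"
      using V in_V(1)[OF z] by (simp add: form_star form_br closed br_skew[of a] form_minus)
    also have "\<dots> = \<omega> a (x \<ast> (y \<odot> z)) + \<omega> a (y \<ast> (x \<odot> z))
        - (\<omega> a (\<lbrakk>x, y\<rbrakk> \<ast> z) + \<omega> a (\<lbrakk>y, x\<rbrakk> \<ast> z))"
      using V in_V(1)[OF z] by (simp add: form_diff closed flip: app1'[OF x y z] app1'[OF y x z])
    also have "\<omega> a (\<lbrakk>x, y\<rbrakk> \<ast> z) + \<omega> a (\<lbrakk>y, x\<rbrakk> \<ast> z) = 0"
      using V in_V(1)[OF z] by (simp add: br_skew[of x y] ast.mult_minus form_minus closed)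
    also have "\<omega> a (x \<ast> (y \<odot> z)) + \<omega> a (y \<ast> (x \<odot> z)) - 0 = - \<omega> \<lbrakk>x \<star> y, a\<rbrakk> z"
      using V in_V(1)[OF z] by (simp add: form_br star_circ[OF x y z] form_diff form_minus closed)
    also have "\<dots> = \<omega> \<lbrakk>a, x \<star> y\<rbrakk> z"
      using V in_V(1)[OF z] by (simp add: br_skew[of a] form_minus closed)
    finally show "\<omega> \<lbrakk>a, x \<star> y\<rbrakk> z = \<omega> (\<lbrakk>a, x\<rbrakk> \<star> y + x \<star> \<lbrakk>a, y\<rbrakk>) z" ..
  qed (simp_all add: V in_V closed mx form_add)
  show "\<lbrakk>x, y \<star> a\<rbrakk> = \<lbrakk>x, y\<rbrakk> \<star> a + y \<star> \<lbrakk>x, a\<rbrakk>"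
  proof (rule polar_eqI)
    fix z assume z: "z \<in> P"
    have "\<omega> (\<lbrakk>x, y\<rbrakk> \<star> a + y \<star> \<lbrakk>x, a\<rbrakk>) z = - \<omega> a (\<lbrakk>x, y\<rbrakk> \<ast> z) - \<omega> a (x \<odot> (y \<ast> z))"
      using V in_V(1)[OF z] by (simp add: form_add form_star form_br closed)
    also have "\<dots> = - \<omega> a (y \<ast> (x \<odot> z))"
      using V in_V(1)[OF z] by (simp add: form_diff closed flip: app1'[OF y x z])
    also have "\<dots> = \<omega> \<lbrakk>x, y \<star> a\<rbrakk> z"
      using V in_V(1)[OF z] by (simp add: form_star form_br closed)
    finally show "\<omega> \<lbrakk>x, y \<star> a\<rbrakk> z = \<omega> (\<lbrakk>x, y\<rbrakk> \<star> a + y \<star> \<lbrakk>x, a\<rbrakk>) z" ..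
  qed (simp_all add: V in_V closed mx form_add)
qed

lemma trilinear_zero:
  fixes F :: "'v \<Rightarrow> 'v \<Rightarrow> 'v \<Rightarrow> 'v"
  assumes add: "\<And>u u' v w. \<lbrakk>u \<in> V; u' \<in> V; v \<in> V; w \<in> V\<rbrakk> \<Longrightarrow> F (u + u') v w = F u v w + F u' v w"
      "\<And>u v v' w. \<lbrakk>u \<in> V; v \<in> V; v' \<in> V; w \<in> V\<rbrakk> \<Longrightarrow> F u (v + v') w = F u v w + F u v' w"
      "\<And>u v w w'. \<lbrakk>u \<in> V; v \<in> V; w \<in> V; w' \<in> V\<rbrakk> \<Longrightarrow> F u v (w + w') = F u v w + F u v w'"
    and hom: "\<And>u v w. \<lbrakk>u \<in> P \<union> Q; v \<in> P \<union> Q; w \<in> P \<union> Q\<rbrakk> \<Longrightarrow> F u v w = 0"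
    and V: "u \<in> V" "v \<in> V" "w \<in> V"
  shows "F u v w = 0"
proof -
  obtain p q p' q' p'' q'' where d: "p \<in> P" "q \<in> Q" "p' \<in> P" "q' \<in> Q" "p'' \<in> P" "q'' \<in> Q"
    "u = p + q" "v = p' + q'" "w = p'' + q''"
    using V decomposition by meson
  then show ?thesis
    using hom in_V by (simp add: add closed)
qed

text \<open>
  Among three homogeneous elements two come from the same summand, and the symmetries of the star
  product and the bracket move the third one to the position treated in \<open>polar_identities\<close>.
\<close>

lemma Poisson_if_mixed_identities:
  assumes mixed: "mixed_identities P Q" "mixed_identities Q P"
  shows "Poisson_algebra s V (\<lambda>x y. x \<star> y) (\<lambda>x y. \<lbrakk>x, y\<rbrakk>)"
proof -
  interpret S: polarised_invariant_form s V "(\<ast>)" "(\<odot>)" \<omega> Q P by (rule swap)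
  interpret PP: Poisson_algebra s P "anticommutator (\<ast>)" "commutator (\<odot>)"
    by (rule anti_pre_Poisson_algebra.sub_adjacent_Poisson[OF P_algebra])
  interpret QP: Poisson_algebra s Q "anticommutator (\<ast>)" "commutator (\<odot>)"
    by (rule anti_pre_Poisson_algebra.sub_adjacent_Poisson[OF Q_algebra])
  note pol = polar_identities[OF _ _ _ mixed(1)] S.polar_identities[OF _ _ _ mixed(2)]
  have assoc: "(u \<star> v) \<star> w - u \<star> (v \<star> w) = 0" if "u \<in> V" "v \<in> V" "w \<in> V" for u v w
  proof (rule trilinear_zero[where F = "\<lambda>u v w. (u \<star> v) \<star> w - u \<star> (v \<star> w)", OF _ _ _ _ that])
    define A where "A u v w \<longleftrightarrow> (u \<star> v) \<star> w = u \<star> (v \<star> w)" for u v w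
    have A_perm: "A x a y" "A a x y" if "A x y a" "A y x a" for x y a
      using that unfolding A_def by (metis star_commute)+
    have "A x y z" if "x \<in> P \<and> y \<in> P \<or> x \<in> Q \<and> y \<in> Q" "z \<in> P \<union> Q" for x y z
      using that by (auto simp: A_def pol PP.star_assoc QP.star_assoc)
    with A_perm have "A u v w" if "u \<in> P \<union> Q" "v \<in> P \<union> Q" "w \<in> P \<union> Q" for u v w
      using that by blast
    then show "(u \<star> v) \<star> w - u \<star> (v \<star> w) = 0" if "u \<in> P \<union> Q" "v \<in> P \<union> Q" "w \<in> P \<union> Q" for u v w
      using that by (simp add: A_def)
  qed (simp_all add: star.mult_add closed)
  have jacobi: "\<lbrakk>\<lbrakk>u, v\<rbrakk>, w\<rbrakk> + \<lbrakk>\<lbrakk>v, w\<rbrakk>, u\<rbrakk> + \<lbrakk>\<lbrakk>w, u\<rbrakk>, v\<rbrakk> = 0" if "u \<in> V" "v \<in> V" "w \<in> V" for u v w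
  proof (rule trilinear_zero[where F = "\<lambda>u v w. \<lbrakk>\<lbrakk>u, v\<rbrakk>, w\<rbrakk> + \<lbrakk>\<lbrakk>v, w\<rbrakk>, u\<rbrakk> + \<lbrakk>\<lbrakk>w, u\<rbrakk>, v\<rbrakk>", OF _ _ _ _ that])
    define J where "J u v w \<longleftrightarrow> \<lbrakk>\<lbrakk>u, v\<rbrakk>, w\<rbrakk> + \<lbrakk>\<lbrakk>v, w\<rbrakk>, u\<rbrakk> + \<lbrakk>\<lbrakk>w, u\<rbrakk>, v\<rbrakk> = 0" for u v w
    have J_perm: "J v w u" "J w u v" if "J u v w" for u v w
      using that by (simp_all add: J_def algebra_simps)
    have "J x y z" if "x \<in> P \<and> y \<in> P \<or> x \<in> Q \<and> y \<in> Q" "z \<in> P \<union> Q" for x y z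
      using that PP.jacobi[of x y z] QP.jacobi[of x y z] jacobi_iff_derivation[of x y z]
      by (auto simp: J_def pol(2,6) in_V)
    with J_perm have "J u v w" if "u \<in> P \<union> Q" "v \<in> P \<union> Q" "w \<in> P \<union> Q" for u v w
      using that by blast
    then show "\<lbrakk>\<lbrakk>u, v\<rbrakk>, w\<rbrakk> + \<lbrakk>\<lbrakk>v, w\<rbrakk>, u\<rbrakk> + \<lbrakk>\<lbrakk>w, u\<rbrakk>, v\<rbrakk> = 0"
      if "u \<in> P \<union> Q" "v \<in> P \<union> Q" "w \<in> P \<union> Q" for u v w
      using that by (simp add: J_def)
  qed (simp_all add: br.mult_add closed)
  have leibniz: "\<lbrakk>u, v \<star> w\<rbrakk> - (\<lbrakk>u, v\<rbrakk> \<star> w + v \<star> \<lbrakk>u, w\<rbrakk>) = 0" if "u \<in> V" "v \<in> V" "w \<in> V" for u v w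
  proof (rule trilinear_zero[where F = "\<lambda>u v w. \<lbrakk>u, v \<star> w\<rbrakk> - (\<lbrakk>u, v\<rbrakk> \<star> w + v \<star> \<lbrakk>u, w\<rbrakk>)", OF _ _ _ _ that])
    define L where "L u v w \<longleftrightarrow> \<lbrakk>u, v \<star> w\<rbrakk> = \<lbrakk>u, v\<rbrakk> \<star> w + v \<star> \<lbrakk>u, w\<rbrakk>" for u v w
    have L_perm: "L u w v" if "L u v w" for u v w
      using that unfolding L_def by (metis star_commute add.commute)
    have "L z x y" "L x y z" if "x \<in> P \<and> y \<in> P \<or> x \<in> Q \<and> y \<in> Q" "z \<in> P \<union> Q" for x y z
      using that by (auto simp: L_def pol PP.leibniz QP.leibniz)
    with L_perm have "L u v w" if "u \<in> P \<union> Q" "v \<in> P \<union> Q" "w \<in> P \<union> Q" for u v w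
      using that by blast
    then show "\<lbrakk>u, v \<star> w\<rbrakk> - (\<lbrakk>u, v\<rbrakk> \<star> w + v \<star> \<lbrakk>u, w\<rbrakk>) = 0"
      if "u \<in> P \<union> Q" "v \<in> P \<union> Q" "w \<in> P \<union> Q" for u v w
      using that by (simp add: L_def)
  qed (simp_all add: br.mult_add star.mult_add closed)
  show ?thesis
  proof unfold_locales
    show "x \<star> y = y \<star> x" for x y by (rule star_commute)
    show "\<lbrakk>x, x\<rbrakk> = 0" for x by (simp add: commutator_def)
  qed (use assoc jacobi leibniz in simp_all)
qed

theorem Poisson_iff_mixed_identities:
  "Poisson_algebra s V (\<lambda>x y. x \<star> y) (\<lambda>x y. \<lbrakk>x, y\<rbrakk>) \<longleftrightarrow> mixed_identities P Q \<and> mixed_identities Q P"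
proof -
  have "mixed_identities X Y" 
    if P: "Poisson_algebra s V (\<lambda>x y. x \<star> y) (\<lambda>x y. \<lbrakk>x, y\<rbrakk>)" and "X \<subseteq> V" "Y \<subseteq> V" for X Y
  proof -
    interpret Poisson_algebra s V "\<lambda>x y. x \<star> y" "\<lambda>x y. \<lbrakk>x, y\<rbrakk>" by fact
    have jac: "\<lbrakk>\<lbrakk>x, y\<rbrakk>, a\<rbrakk> = \<lbrakk>x, \<lbrakk>y, a\<rbrakk>\<rbrakk> - \<lbrakk>y, \<lbrakk>x, a\<rbrakk>\<rbrakk>" if "x \<in> V" "y \<in> V" "a \<in> V" for x y a
      using jacobi[of x y a] jacobi_iff_derivation[of x y a] that by simp
    show ?thesis
      unfolding mixed_identities_def
    proof (intro ballI)
      fix x y a b assume "x \<in> X" "y \<in> X" "a \<in> Y" "b \<in> Y"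
      then have "x \<in> V" "y \<in> V" "a \<in> V" "b \<in> V" using that by auto
      then show "\<omega> ((x \<star> y) \<star> a) b = \<omega> (x \<star> (y \<star> a)) b \<and>
          \<omega> \<lbrakk>\<lbrakk>x, y\<rbrakk>, a\<rbrakk> b = \<omega> \<lbrakk>x, \<lbrakk>y, a\<rbrakk>\<rbrakk> b - \<omega> \<lbrakk>y, \<lbrakk>x, a\<rbrakk>\<rbrakk> b \<and>
          \<omega> \<lbrakk>a, x \<star> y\<rbrakk> b = \<omega> (\<lbrakk>a, x\<rbrakk> \<star> y) b + \<omega> (x \<star> \<lbrakk>a, y\<rbrakk>) b \<and>
          \<omega> \<lbrakk>x, y \<star> a\<rbrakk> b = \<omega> (\<lbrakk>x, y\<rbrakk> \<star> a) b + \<omega> (y \<star> \<lbrakk>x, a\<rbrakk>) b"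
        by (simp add: star_assoc jac leibniz form_diff form_add closed)
    qed
  qed
  then show ?thesis
    using Poisson_if_mixed_identities P_sub Q_sub by blast
qed

end


section \<open>Uniqueness of invariant products\<close>

context invariant_form
begin

lemma form_ast_symmetric:
  assumes "x \<in> V" "y \<in> V" "z \<in> V"
  shows "\<omega> (x \<ast> y) z = \<omega> (z \<ast> y) x"
  using assms by (simp add: form_ast star_commute[of x z])

lemma form_ast_cyclic:
  assumes "x \<in> V" "y \<in> V" "z \<in> V"
  shows "\<omega> (x \<ast> y) z + \<omega> (y \<ast> z) x + \<omega> (z \<ast> x) y = 0"
proof -
  have T: "\<omega> (a \<ast> b) c = - \<omega> (a \<star> c) b" if "a \<in> V" "b \<in> V" "c \<in> V" for a b c
    using form_ast[OF that] form_symmetric[of b "a \<star> c"] that by (simp add: closed)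
  have "\<omega> (x \<ast> y) z + \<omega> (y \<ast> z) x + \<omega> (z \<ast> x) y
      = - (\<omega> (x \<star> z) y + \<omega> (z \<star> y) x + \<omega> (y \<star> x) z)"
    using assms by (simp add: T)
  then show ?thesis
    using form_star_cyclic[of x z y] assms by simp
qed

lemma form_circ_skew:
  assumes "x \<in> V" "y \<in> V" "z \<in> V"
  shows "\<omega> (x \<odot> y) z = - \<omega> (z \<odot> y) x"
  using assms by (simp add: form_circ br_skew[of x z] form_minus closed)

lemma form_circ_cyclic:
  assumes "x \<in> V" "y \<in> V" "z \<in> V"
  shows "\<omega> (x \<odot> y) z + \<omega> (y \<odot> z) x + \<omega> (z \<odot> x) y = 0"
proof -
  have "\<omega> (x \<odot> y) z = \<omega> (x \<odot> z) y - \<omega> (z \<odot> x) y"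
    using assms by (simp add: form_circ[of x y z] commutator_def form_diff form_symmetric[of y] closed)
  with form_circ_skew[of x z y] show ?thesis using assms by simp
qed

end

context polarised_invariant_form
begin

text \<open>
  Used for the difference of two invariant products, with \<open>\<epsilon>\<close> equal to 1 or -1. For \<open>x\<close>, \<open>y\<close> from
  different summands, \<open>\<omega> (d x y) z\<close> reduces by the symmetries to values of \<open>d\<close> on two elements of the
  same summand: exchange \<open>x\<close> and \<open>z\<close> if \<open>z\<close> lies with \<open>y\<close>, and use the cyclic sum if \<open>z\<close> lies with \<open>x\<close>.
\<close>

lemma bilinear_zeroI:
  assumes closed_d: "\<And>x y. x \<in> V \<Longrightarrow> y \<in> V \<Longrightarrow> d x y \<in> V"
    and add: "\<And>x x' y. \<lbrakk>x \<in> V; x' \<in> V; y \<in> V\<rbrakk> \<Longrightarrow> d (x + x') y = d x y + d x' y"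
      "\<And>x y y'. \<lbrakk>x \<in> V; y \<in> V; y' \<in> V\<rbrakk> \<Longrightarrow> d x (y + y') = d x y + d x y'"
    and outer: "\<And>x y z. \<lbrakk>x \<in> V; y \<in> V; z \<in> V\<rbrakk> \<Longrightarrow> \<omega> (d x y) z = \<epsilon> * \<omega> (d z y) x"
    and cyclic: "\<And>x y z. \<lbrakk>x \<in> V; y \<in> V; z \<in> V\<rbrakk> \<Longrightarrow> \<omega> (d x y) z + \<omega> (d y z) x + \<omega> (d z x) y = 0"
    and zero: "\<And>x y. x \<in> P \<Longrightarrow> y \<in> P \<Longrightarrow> d x y = 0" "\<And>x y. x \<in> Q \<Longrightarrow> y \<in> Q \<Longrightarrow> d x y = 0"
    and V: "u \<in> V" "v \<in> V"
  shows "d u v = 0"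
proof -
  have 1: "\<omega> (d x y) z = 0" if "x \<in> V" "y \<in> V" "z \<in> V" "d z y = 0" for x y z
    using outer[of x y z] that by (simp add: form_zero)
  have 2: "\<omega> (d x y) z = 0" if "x \<in> V" "y \<in> V" "z \<in> V" "d x z = 0" "d z x = 0" for x y z
    using cyclic[of x y z] 1[of y z x] that by (simp add: form_zero)
  have mixed: "d x y = 0" if "x \<in> P \<and> y \<in> Q \<or> x \<in> Q \<and> y \<in> P" for x y
  proof (rule polar_eqI)
    show "d x y \<in> V" using that in_V closed_d by blast
    show "0 \<in> V" by (rule closed)
    show "\<omega> (d x y) z = \<omega> 0 z" if "z \<in> P" for z
      using \<open>x \<in> P \<and> y \<in> Q \<or> x \<in> Q \<and> y \<in> P\<close> that 1[of x y z] 2[of x y z] in_V zero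
      by (auto simp: form_zero)
    show "\<omega> (d x y) z = \<omega> 0 z" if "z \<in> Q" for z
      using \<open>x \<in> P \<and> y \<in> Q \<or> x \<in> Q \<and> y \<in> P\<close> that 1[of x y z] 2[of x y z] in_V zero
      by (auto simp: form_zero)
  qed
  obtain p q p' q' where "p \<in> P" "q \<in> Q" "p' \<in> P" "q' \<in> Q" "u = p + q" "v = p' + q'"
    using V decomposition by meson
  then show ?thesis
    using in_V zero mixed by (simp add: add closed)
qed

theorem invariant_products_unique:
  assumes inv: "invariant_form s V ast' circ' \<omega>"
    and P: "\<And>x y. \<lbrakk>x \<in> P; y \<in> P\<rbrakk> \<Longrightarrow> ast' x y = x \<ast> y \<and> circ' x y = x \<odot> y"
    and Q: "\<And>x y. \<lbrakk>x \<in> Q; y \<in> Q\<rbrakk> \<Longrightarrow> ast' x y = x \<ast> y \<and> circ' x y = x \<odot> y"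
    and V: "u \<in> V" "v \<in> V"
  shows "ast' u v = u \<ast> v" and "circ' u v = u \<odot> v"
proof -
  interpret I: invariant_form s V ast' circ' \<omega> by (rule inv)
  have "ast' u v - u \<ast> v = 0"
  proof (rule bilinear_zeroI[where d = "\<lambda>u v. ast' u v - u \<ast> v" and \<epsilon> = 1, OF _ _ _ _ _ _ _ V])
    fix x y z assume V: "x \<in> V" "y \<in> V" "z \<in> V"
    show "\<omega> (ast' x y - x \<ast> y) z = 1 * \<omega> (ast' z y - z \<ast> y) x"
      using V form_ast_symmetric[OF V] I.form_ast_symmetric[OF V]
      by (simp add: form_diff closed I.closed)
    show "\<omega> (ast' x y - x \<ast> y) z + \<omega> (ast' y z - y \<ast> z) x + \<omega> (ast' z x - z \<ast> x) y = 0"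
      using V form_ast_cyclic[OF V] I.form_ast_cyclic[OF V]
      by (simp add: form_diff closed I.closed) algebra
  qed (simp_all add: P Q ast.mult_add I.ast.mult_add closed I.closed)
  then show "ast' u v = u \<ast> v" by simp
  have "circ' u v - u \<odot> v = 0"
  proof (rule bilinear_zeroI[where d = "\<lambda>u v. circ' u v - u \<odot> v" and \<epsilon> = "-1", OF _ _ _ _ _ _ _ V])
    fix x y z assume V: "x \<in> V" "y \<in> V" "z \<in> V"
    show "\<omega> (circ' x y - x \<odot> y) z = - 1 * \<omega> (circ' z y - z \<odot> y) x"
      using V form_circ_skew[OF V] I.form_circ_skew[OF V]
      by (simp add: form_diff closed I.closed)
    show "\<omega> (circ' x y - x \<odot> y) z + \<omega> (circ' y z - y \<odot> z) x + \<omega> (circ' z x - z \<odot> x) y = 0"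
      using V form_circ_cyclic[OF V] I.form_circ_cyclic[OF V]
      by (simp add: form_diff closed I.closed) algebra
  qed (simp_all add: P Q circ.mult_add I.circ.mult_add closed I.closed)
  then show "circ' u v = u \<odot> v" by simp
qed

end

text \<open>
  Transports the structure to the two summands of a direct sum, and, along the identity, to products
  that agree on the carrier.
\<close>

lemma anti_pre_Poisson_image:
  assumes A: "anti_pre_Poisson_algebra s V ast0 circ0"
    and W: "vector_space s'"
    and i: "\<And>x y. x \<in> V \<Longrightarrow> y \<in> V \<Longrightarrow> i (x + y) = i x + i y" "\<And>c x. x \<in> V \<Longrightarrow> i (s c x) = s' c (i x)"
    and sub: "subalgebra_via i V ast0 circ0 ast circ"
  shows "anti_pre_Poisson_algebra s' (i ` V) ast circ"
proof -
  interpret anti_pre_Poisson_algebra s V ast0 circ0 by (rule A)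
  interpret W: vector_space s' by (rule W)
  note closed = carrier_closed ast_in circ_in
  have ac: "ast (i x) (i y) = i (ast0 x y)" "circ (i x) (i y) = i (circ0 x y)" if "x \<in> V" "y \<in> V" for x y
    using sub that by (simp_all add: subalgebra_via_def)
  have i0: "i 0 = 0" using i(1)[of 0 0] by (simp add: closed)
  have id: "i (x - y) = i x - i y" if "x \<in> V" "y \<in> V" for x y
    using i(1)[of "x - y" y] that by (simp add: closed)
  have im: "i (- x) = - i x" if "x \<in> V" for x
    using id[of 0 x] that by (simp add: closed i0)
  note h = i(1) id im i0 ac
  have W: "W.subspace (i ` V)"
    unfolding W.subspace_def
    by (auto simp: closed simp flip: i i0 intro!: imageI)
  have bil: "bilinear_map s' (i ` V) s' (i ` V) s' (i ` V) ast"
    "bilinear_map s' (i ` V) s' (i ` V) s' (i ` V) circ"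
    unfolding bilinear_map_def ball_simps
    by (auto simp: ac closed ast_add circ_add algebra_on.mult_scale[OF ast_algebra]
        algebra_on.mult_scale[OF circ_algebra] simp flip: i)
  show ?thesis
  proof (unfold_locales, goal_cases)
    case 1 show ?case by (rule W)
  next
    case 2 show ?case by (rule bil)
  next
    case (3 x y z)
    then obtain x' y' z' where V: "x' \<in> V" "y' \<in> V" "z' \<in> V" "x = i x'" "y = i y'" "z = i z'" by blast
    then show ?case
      using arg_cong[OF az1[OF V(1-3)], of i] by (simp add: closed ac flip: id im i(1))
  next
    case (4 x y z)
    then obtain x' y' z' where V: "x' \<in> V" "y' \<in> V" "z' \<in> V" "x = i x'" "y = i y'" "z = i z'" by blast
    then show ?case
      using arg_cong[OF az2[OF V(1-3)], of i] by (simp add: closed ac flip: id im i(1))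
  next
    case (5 x y z)
    then obtain x' y' z' where V: "x' \<in> V" "y' \<in> V" "z' \<in> V" "x = i x'" "y = i y'" "z = i z'" by blast
    then show ?case
      using arg_cong[OF az3[OF V(1-3)], of i] by (simp add: closed ac flip: id im i(1))
  next
    case (6 x y z)
    then obtain x' y' z' where V: "x' \<in> V" "y' \<in> V" "z' \<in> V" "x = i x'" "y = i y'" "z = i z'" by blast
    then show ?case
      using arg_cong[OF az4[OF V(1-3)], of i] by (simp add: closed ac flip: id im i(1))
  next
    case 7 show ?case by (rule bil)
  next
    case (8 x y z)
    then obtain x' y' z' where V: "x' \<in> V" "y' \<in> V" "z' \<in> V" "x = i x'" "y = i y'" "z = i z'" by blast
    then show ?case
      using arg_cong[OF apl1[OF V(1-3)], of i] by (simp add: closed ac commutator_def i0 flip: id im i(1))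
  next
    case (9 x y z)
    then obtain x' y' z' where V: "x' \<in> V" "y' \<in> V" "z' \<in> V" "x = i x'" "y = i y'" "z = i z'" by blast
    then show ?case
      using arg_cong[OF apl2[OF V(1-3)], of i] by (simp add: closed ac commutator_def i0 flip: id im i(1))
  next
    case (10 x y z)
    then obtain x' y' z' where V: "x' \<in> V" "y' \<in> V" "z' \<in> V" "x = i x'" "y = i y'" "z = i z'" by blast
    then show ?case
      using arg_cong[OF app1[OF V(1-3)], of i] by (simp add: closed ac flip: id im i(1))
  next
    case (11 x y z)
    then obtain x' y' z' where V: "x' \<in> V" "y' \<in> V" "z' \<in> V" "x = i x'" "y = i y'" "z = i z'" by blast
    then show ?case
      using arg_cong[OF app2[OF V(1-3)], of i] by (simp add: closed ac flip: id im i(1))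
  next
    case (12 x y z)
    then obtain x' y' z' where V: "x' \<in> V" "y' \<in> V" "z' \<in> V" "x = i x'" "y = i y'" "z = i z'" by blast
    then show ?case
      using arg_cong[OF app3[OF V(1-3)], of i] by (simp add: closed ac flip: id im i(1))
  qed
qed


section \<open>The double of an algebra and its dual\<close>

lemma linear_to_End_pointwise:
  assumes "vector_space sW" "module.subspace sW W"
    and "linear_to_End sV V sW W f" "linear_to_End sV V sW W g"
  shows "linear_to_End sV V sW W (f + g)" "linear_to_End sV V sW W (f - g)" "linear_to_End sV V sW W (- f)"
proof -
  interpret vector_space sW by fact
  show "linear_to_End sV V sW W (f + g)" "linear_to_End sV V sW W (f - g)" "linear_to_End sV V sW W (- f)"
    using assms by (auto simp: bilinear_map_def subspace_add subspace_diff subspace_neg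
        scale_right_distrib scale_right_diff_distrib algebra_simps)
qed

lemma algebra_on_sum:
  assumes 1: "algebra_on s1 A1 m1" and 2: "algebra_on s2 A2 m2"
    and l: "linear_to_End s1 A1 s2 A2 l1" "linear_to_End s1 A1 s2 A2 r1"
      "linear_to_End s2 A2 s1 A1 l2" "linear_to_End s2 A2 s1 A1 r2"
  shows "algebra_on (sum_scale s1 s2) (A1 \<times> A2)
    (\<lambda>(x, a) (y, b). (m1 x y + l2 a y + r2 b x, m2 a b + l1 x b + r1 y a))"
proof -
  interpret A1: algebra_on s1 A1 m1 by (rule 1)
  interpret A2: algebra_on s2 A2 m2 by (rule 2)
  interpret V: vector_space "sum_scale s1 s2"
    by (rule vector_space_sum_scale) unfold_locales
  have l': "l1 x a \<in> A2" "r1 x a \<in> A2" "l2 a x \<in> A1" "r2 a x \<in> A1"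
    "l1 (x + y) a = l1 x a + l1 y a" "r1 (x + y) a = r1 x a + r1 y a"
    "l1 x (a + b) = l1 x a + l1 x b" "r1 x (a + b) = r1 x a + r1 x b"
    "l2 (a + b) x = l2 a x + l2 b x" "r2 (a + b) x = r2 a x + r2 b x"
    "l2 a (x + y) = l2 a x + l2 a y" "r2 a (x + y) = r2 a x + r2 a y"
    "l1 (s1 c x) a = s2 c (l1 x a)" "r1 (s1 c x) a = s2 c (r1 x a)"
    "l2 (s2 c a) x = s1 c (l2 a x)" "r2 (s2 c a) x = s1 c (r2 a x)"
    "l1 x (s2 c a) = s2 c (l1 x a)" "r1 x (s2 c a) = s2 c (r1 x a)"
    "l2 a (s1 c x) = s1 c (l2 a x)" "r2 a (s1 c x) = s1 c (r2 a x)"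
    if "x \<in> A1" "y \<in> A1" "a \<in> A2" "b \<in> A2" for x y a b c
    using that l by (simp_all add: bilinear_map_def)
  show ?thesis
  proof unfold_locales
    show "V.subspace (A1 \<times> A2)"
      by (auto simp: V.subspace_def sum_scale_def A1.carrier_closed A2.carrier_closed zero_prod_def)
    show "linear_to_End (sum_scale s1 s2) (A1 \<times> A2) (sum_scale s1 s2) (A1 \<times> A2)
        (\<lambda>(x, a) (y, b). (m1 x y + l2 a y + r2 b x, m2 a b + l1 x b + r1 y a))"
      unfolding bilinear_map_def
      by (auto simp: sum_scale_def A1.carrier_closed A2.carrier_closed A1.mult_in A2.mult_in
          A1.mult_add A2.mult_add A1.mult_scale A2.mult_scale l' A1.scale_right_distrib A2.scale_right_distrib
          algebra_simps)
  qed
qed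

lemma linear_mult:
  assumes "algebra_on sc V m"
  shows "linear_to_End sc V sc V (Lmul m)" "linear_to_End sc V sc V (Rmul m)"
proof -
  interpret algebra_on sc V m by fact
  show "linear_to_End sc V sc V (Lmul m)" "linear_to_End sc V sc V (Rmul m)"
    by (auto simp: bilinear_map_def Lmul_def Rmul_def mult_in mult_add mult_scale)
qed

locale dual_algebra_pair = finite_dimensional_vector_space s Basis
  for s :: "'k::field \<Rightarrow> 'a::ab_group_add \<Rightarrow> 'a" and Basis +
  fixes ast1 circ1 :: "'a \<Rightarrow> 'a \<Rightarrow> 'a" and ast2 circ2 :: "('a \<Rightarrow> 'k) \<Rightarrow> ('a \<Rightarrow> 'k) \<Rightarrow> ('a \<Rightarrow> 'k)"
  assumes A: "anti_pre_Poisson_algebra s UNIV ast1 circ1"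
    and D: "anti_pre_Poisson_algebra dual_scale (dual_space s) ast2 circ2"
begin

sublocale A: anti_pre_Poisson_algebra s UNIV ast1 circ1 by (rule A)
sublocale D: anti_pre_Poisson_algebra dual_scale "dual_space s" ast2 circ2 by (rule D)

abbreviation "dual \<equiv> dual_space s"

text \<open>
  The left-hand sides match any application, so the longer simplifications below fix \<open>b\<close> first.
\<close>

lemma dual_linear:
  assumes "b \<in> dual"
  shows "b (x + y) = b x + b y" "b (x - y) = b x - b y" "b (- x) = - b x" "b 0 = 0" "b (s c x) = c * b x"
proof -
  show add: "b (x + y) = b x + b y" and "b (s c x) = c * b x" for x y
    using assms by (simp_all add: dual_space_iff vector_space_axioms)
  show zero: "b 0 = 0" using add[of 0 0] by (metis add_0 add_cancel_right_right)
  show "b (x - y) = b x - b y" for x y using add[of "x - y" y] by simp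
  from this[of 0 x] show "b (- x) = - b x" by (simp add: zero)
qed

lemma dual_algebras:
  "algebra_on dual_scale dual ast2" "algebra_on dual_scale dual circ2"
  by (rule D.ast_algebra D.circ_algebra)+

lemma base_algebras: "algebra_on s UNIV ast1" "algebra_on s UNIV circ1"
  by (rule A.ast_algebra A.circ_algebra)+

lemma linear_dual_action:
  assumes f: "linear_to_End s UNIV s UNIV f"
  shows "linear_to_End s UNIV dual_scale dual (dual_action f)"
proof -
  have f': "f (x + x') y = f x y + f x' y" "f x (y + y') = f x y + f x y'"
    "f (s c x) y = s c (f x y)" "f x (s c y) = s c (f x y)" for x x' y y' c
    using f by (simp_all add: bilinear_map_def)
  show ?thesis
    unfolding bilinear_map_def
  proof (intro conjI ballI allI)
    fix x x' a a' c assume a: "a \<in> dual" "a' \<in> dual"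
    show "dual_action f x a \<in> dual"
      by (simp add: dual_space_iff[OF vector_space_axioms] dual_action_def f' dual_linear[OF a(1)])
    show "dual_action f (x + x') a = dual_action f x a + dual_action f x' a"
      "dual_action f x (a + a') = dual_action f x a + dual_action f x a'"
      "dual_action f (s c x) a = dual_scale c (dual_action f x a)"
      "dual_action f x (dual_scale c a) = dual_scale c (dual_action f x a)"
      by (simp_all add: fun_eq_iff dual_action_def fun_scale_def f' dual_linear[OF a(1)])
  qed
qed

lemma linear_bidual_action:
  assumes f: "linear_to_End dual_scale dual dual_scale dual f"
  shows "linear_to_End dual_scale dual s UNIV (bidual_action s f)"
proof -
  have f': "f a b \<in> dual" "f (a + a') b = f a b + f a' b" "f (dual_scale c a) b = dual_scale c (f a b)"
    "a + a' \<in> dual" "dual_scale c a \<in> dual"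
    if "a \<in> dual" "a' \<in> dual" "b \<in> dual" for a a' b c
    using f that by (simp_all add: bilinear_map_def D.carrier_closed del: plus_fun_apply)
  show ?thesis
    unfolding bilinear_map_def
  proof (intro conjI ballI allI UNIV_I)
    fix a a' x y c assume a: "a \<in> dual" "a' \<in> dual"
    note ev = bidual_action_eq[OF f]
    show "bidual_action s f (a + a') x = bidual_action s f a x + bidual_action s f a' x"
      by (rule dual_separates) (simp add: dual_linear ev f' a)
    show "bidual_action s f a (x + y) = bidual_action s f a x + bidual_action s f a y"
      by (rule dual_separates) (simp add: dual_linear[of "f a _"] ev f' a,
        simp add: dual_linear ev f' a)
    show "bidual_action s f (dual_scale c a) x = s c (bidual_action s f a x)"
      by (rule dual_separates) (simp add: dual_linear ev f' a, simp add: fun_scale_def)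
    show "bidual_action s f a (s c x) = s c (bidual_action s f a x)"
      by (rule dual_separates) (simp add: dual_linear ev f' a)
  qed
qed

lemma action_linear:
  "linear_to_End s UNIV dual_scale dual (dual_action (Lmul ast1))"
  "linear_to_End s UNIV dual_scale dual (dual_action (Rmul ast1))"
  "linear_to_End s UNIV dual_scale dual (dual_action (Lmul circ1))"
  "linear_to_End s UNIV dual_scale dual (dual_action (Rmul circ1))"
  "linear_to_End dual_scale dual s UNIV (bidual_action s (Lmul ast2))"
  "linear_to_End dual_scale dual s UNIV (bidual_action s (Rmul ast2))"
  "linear_to_End dual_scale dual s UNIV (bidual_action s (Lmul circ2))"
  "linear_to_End dual_scale dual s UNIV (bidual_action s (Rmul circ2))"
  by (intro linear_dual_action linear_bidual_action linear_mult base_algebras dual_algebras)+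

lemmas pointwise_linear =
  linear_to_End_pointwise[OF vector_space_axioms subspace_UNIV]
  linear_to_End_pointwise[OF vector_space_fun_scale[OF vector_space_field] subspace_dual]

text \<open>
  The products on the direct sum that appear in the matched pair of anti-pre-Poisson algebras.
\<close>

definition double_ast :: "'a \<times> ('a \<Rightarrow> 'k) \<Rightarrow> 'a \<times> ('a \<Rightarrow> 'k) \<Rightarrow> 'a \<times> ('a \<Rightarrow> 'k)" where
  "double_ast = (\<lambda>(x, a) (y, b).
    (ast1 x y + (bidual_action s (Lmul ast2) + bidual_action s (Rmul ast2)) a y
       + (- bidual_action s (Rmul ast2)) b x,
     ast2 a b + (dual_action (Lmul ast1) + dual_action (Rmul ast1)) x b + (- dual_action (Rmul ast1)) y a))"

definition double_circ :: "'a \<times> ('a \<Rightarrow> 'k) \<Rightarrow> 'a \<times> ('a \<Rightarrow> 'k) \<Rightarrow> 'a \<times> ('a \<Rightarrow> 'k)" where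
  "double_circ = (\<lambda>(x, a) (y, b).
    (circ1 x y + (bidual_action s (Rmul circ2) - bidual_action s (Lmul circ2)) a y
       + bidual_action s (Rmul circ2) b x,
     circ2 a b + (dual_action (Rmul circ1) - dual_action (Lmul circ1)) x b + dual_action (Rmul circ1) y a))"

abbreviation "double_scale \<equiv> sum_scale s dual_scale"
abbreviation "double \<equiv> (UNIV :: 'a set) \<times> dual"
abbreviation pairing :: "'a \<times> ('a \<Rightarrow> 'k) \<Rightarrow> 'a \<times> ('a \<Rightarrow> 'k) \<Rightarrow> 'k" where
  "pairing \<equiv> (\<lambda>(x, a) (y, b). b x + a y)"

text \<open>
  Here and in the next lemma the right-hand side is literally the operation of the matched pair of
  Poisson algebras. The right multiplications cancel, only the left multiplications survive.
\<close>

lemma anticommutator_double_ast: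
  "anticommutator double_ast = (\<lambda>(x, a) (y, b).
    (anticommutator ast1 x y + bidual_action s (Lmul ast2) a y + bidual_action s (Lmul ast2) b x,
     anticommutator ast2 a b + dual_action (Lmul ast1) x b + dual_action (Lmul ast1) y a))"
  by (auto simp: fun_eq_iff anticommutator_def double_ast_def)

lemma commutator_double_circ:
  "commutator double_circ = (\<lambda>(x, a) (y, b).
    (commutator circ1 x y + (- bidual_action s (Lmul circ2)) a y - (- bidual_action s (Lmul circ2)) b x,
     commutator circ2 a b + (- dual_action (Lmul circ1)) x b - (- dual_action (Lmul circ1)) y a))"
  by (auto simp: fun_eq_iff commutator_def double_circ_def)

lemma double_ast_algebra: "algebra_on double_scale double double_ast"
  unfolding double_ast_def
  by (rule algebra_on_sum) (rule base_algebras dual_algebras action_linear pointwise_linear)+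

lemma double_circ_algebra: "algebra_on double_scale double double_circ"
  unfolding double_circ_def
  by (rule algebra_on_sum) (rule base_algebras dual_algebras action_linear pointwise_linear)+

lemma bidual_eval:
  assumes "a \<in> dual" "b \<in> dual"
  shows "b (bidual_action s (Lmul ast2) a x) = - ast2 a b x"
    "b (bidual_action s (Rmul ast2) a x) = - ast2 b a x"
    "b (bidual_action s (Lmul circ2) a x) = - circ2 a b x"
    "b (bidual_action s (Rmul circ2) a x) = - circ2 b a x"
  using assms by (simp_all add: bidual_action_eq[OF linear_mult(1)[OF dual_algebras(1)]]
    bidual_action_eq[OF linear_mult(2)[OF dual_algebras(1)]]
    bidual_action_eq[OF linear_mult(1)[OF dual_algebras(2)]]
    bidual_action_eq[OF linear_mult(2)[OF dual_algebras(2)]] Lmul_def Rmul_def)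

lemma dual_eval:
  "dual_action (Lmul m) x a y = - a (m x y)"
  "dual_action (Rmul m) x a y = - a (m y x)"
  by (simp_all add: dual_action_def Lmul_def Rmul_def)

lemma double_invariant_form: "invariant_form double_scale double double_ast double_circ pairing"
proof (intro invariant_form.intro invariant_form_axioms.intro double_ast_algebra double_circ_algebra)
  show "bilinear_map double_scale double double_scale double (*) UNIV pairing"
    unfolding bilinear_map_def
  proof (intro conjI ballI allI UNIV_I)
    fix u v w c assume "u \<in> double" "v \<in> double" "w \<in> double"
    then obtain x a y b z d where [simp]: "u = (x, a)" "v = (y, b)" "w = (z, d)"
      and d: "a \<in> dual" "b \<in> dual" "d \<in> dual"
      by auto
    note lin = dual_linear[OF d(1)] dual_linear[OF d(2)] dual_linear[OF d(3)]
    show "pairing (u + v) w = pairing u w + pairing v w" "pairing u (v + w) = pairing u v + pairing u w"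
      "pairing (double_scale c u) v = c * pairing u v" "pairing u (double_scale c v) = c * pairing u v"
      by (simp_all add: sum_scale_def fun_scale_def lin algebra_simps)
  qed
next
  fix u v w assume "u \<in> double" "v \<in> double" "w \<in> double"
  then obtain x a y b z c where [simp]: "u = (x, a)" "v = (y, b)" "w = (z, c)"
    and d: "a \<in> dual" "b \<in> dual" "c \<in> dual"
    by auto
  note lin = dual_linear[OF d(1)] dual_linear[OF d(2)] dual_linear[OF d(3)]
  show "pairing u v = pairing v u" by simp
  show "pairing (double_ast u v) w = - pairing v (anticommutator double_ast u w)"
    by (simp add: anticommutator_double_ast) 
      (simp add: double_ast_def anticommutator_def lin d bidual_eval dual_eval algebra_simps)
  show "pairing (double_circ u v) w = pairing v (commutator double_circ u w)"
    by (simp add: commutator_double_circ) 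
      (simp add: double_circ_def commutator_def lin d bidual_eval dual_eval algebra_simps)
next
  fix u assume u: "u \<in> double" "\<And>v. v \<in> double \<Longrightarrow> pairing u v = 0"
  obtain x a where [simp]: "u = (x, a)" and a: "a \<in> dual" using u(1) by auto
  have "a y = 0" for y using u(2)[of "(y, 0)"] by (simp add: D.carrier_closed)
  moreover have "x = 0" using u(2)[of "(0, b)" for b] a by (intro dual_separates) (simp add: dual_linear)
  ultimately show "u = 0" by (simp add: zero_prod_def fun_eq_iff)
qed

end


lemma linear_to_End_zero:
  assumes "linear_to_End sV V sW W f" "0 \<in> V" "0 \<in> W"
  shows "w \<in> W \<Longrightarrow> f 0 w = 0" "v \<in> V \<Longrightarrow> f v 0 = 0"
proof -
  have "f (0 + 0) w = f 0 w + f 0 w" if "w \<in> W"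
    using assms that unfolding bilinear_map_def by blast
  then show "w \<in> W \<Longrightarrow> f 0 w = 0" by simp
  have "f v (0 + 0) = f v 0 + f v 0" if "v \<in> V"
    using assms that unfolding bilinear_map_def by blast
  then show "v \<in> V \<Longrightarrow> f v 0 = 0" by simp
qed

context dual_algebra_pair
begin

lemma zero_dual: "0 \<in> dual"
  by (rule D.carrier_closed)

lemmas action_zero =
  action_linear(1-4)[THEN linear_to_End_zero(1), OF UNIV_I zero_dual]
  action_linear(5-8)[THEN linear_to_End_zero(1), OF zero_dual UNIV_I UNIV_I]
  action_linear(1-4)[THEN linear_to_End_zero(2), OF UNIV_I zero_dual UNIV_I]
  action_linear(5-8)[THEN linear_to_End_zero(2), OF zero_dual UNIV_I]

lemmas mult_zero =
  algebra_on.mult_zero[OF base_algebras(1), OF UNIV_I] algebra_on.mult_zero[OF base_algebras(2), OF UNIV_I]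
  algebra_on.mult_zero[OF dual_algebras(1)] algebra_on.mult_zero[OF dual_algebras(2)]

lemma base_subalgebra: "subalgebra_via (\<lambda>x. (x, 0)) UNIV ast1 circ1 double_ast double_circ"
  by (simp add: subalgebra_via_def double_ast_def double_circ_def action_zero mult_zero zero_dual)

lemma dual_subalgebra: "subalgebra_via (\<lambda>a. (0, a)) dual ast2 circ2 double_ast double_circ"
  by (simp add: subalgebra_via_def double_ast_def double_circ_def action_zero mult_zero zero_dual)

lemma vector_space_double: "vector_space double_scale"
  by (intro vector_space_sum_scale vector_space_fun_scale vector_space_field vector_space_axioms)

lemma double_polarised:
  "polarised_invariant_form double_scale double double_ast double_circ pairing
    (range (\<lambda>x. (x, 0))) ((\<lambda>a. (0, a)) ` dual)"
proof (intro polarised_invariant_form.intro polarised_invariant_form_axioms.intro double_invariant_form)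
  show "anti_pre_Poisson_algebra double_scale (range (\<lambda>x. (x, 0))) double_ast double_circ"
    by (rule anti_pre_Poisson_image[OF A vector_space_double _ _ base_subalgebra])
      (simp_all add: sum_scale_def fun_scale_def zero_fun_def)
  show "anti_pre_Poisson_algebra double_scale ((\<lambda>a. (0, a)) ` dual) double_ast double_circ"
    by (rule anti_pre_Poisson_image[OF D vector_space_double _ _ dual_subalgebra])
      (simp_all add: sum_scale_def)
  show "range (\<lambda>x. (x, 0)) \<subseteq> double" "(\<lambda>a. (0, a)) ` dual \<subseteq> double"
    using zero_dual by auto
  show "pairing u v = 0" if "u \<in> range (\<lambda>x. (x, 0))" "v \<in> range (\<lambda>x. (x, 0))" for u v
    using that by auto
  show "pairing u v = 0" if "u \<in> (\<lambda>a. (0, a)) ` dual" "v \<in> (\<lambda>a. (0, a)) ` dual" for u v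
    using that by (auto simp: dual_linear(4))
  show "\<exists>p\<in>range (\<lambda>x. (x, 0)). \<exists>q\<in>(\<lambda>a. (0, a)) ` dual. v = p + q" if "v \<in> double" for v
    using that by (cases v) auto
qed

text \<open>
  Invariance leaves no choice for the products of a quadratic structure that extends the products of
  the two summands.
\<close>

lemma quadratic_iff_double:
  "(\<exists>ast circ. quadratic_anti_pre_Poisson_algebra double_scale double ast circ pairing \<and>
      subalgebra_via (\<lambda>x. (x, 0)) UNIV ast1 circ1 ast circ \<and>
      subalgebra_via (\<lambda>a. (0, a)) dual ast2 circ2 ast circ)
    \<longleftrightarrow> anti_pre_Poisson_algebra double_scale double double_ast double_circ"
proof
  assume "\<exists>ast circ. quadratic_anti_pre_Poisson_algebra double_scale double ast circ pairing \<and>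
      subalgebra_via (\<lambda>x. (x, 0)) UNIV ast1 circ1 ast circ \<and>
      subalgebra_via (\<lambda>a. (0, a)) dual ast2 circ2 ast circ"
  then obtain ast circ where q: "quadratic_anti_pre_Poisson_algebra double_scale double ast circ pairing"
    and sub: "subalgebra_via (\<lambda>x. (x, 0)) UNIV ast1 circ1 ast circ"
      "subalgebra_via (\<lambda>a. (0, a)) dual ast2 circ2 ast circ"
    by blast
  interpret q: quadratic_anti_pre_Poisson_algebra double_scale double ast circ pairing by (rule q)
  interpret polarised_invariant_form double_scale double double_ast double_circ pairing
    "range (\<lambda>x. (x, 0))" "(\<lambda>a. (0, a)) ` dual" by (rule double_polarised)
  have inv: "invariant_form double_scale double ast circ pairing"
    by (intro invariant_form.intro invariant_form_axioms.intro q.ast_algebra q.circ_algebra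
      q.form_bilinear q.form_symmetric q.form_nondegenerate q.form_ast q.form_circ)
  have "ast u v = double_ast u v \<and> circ u v = double_circ u v" if "u \<in> double" "v \<in> double" for u v
  proof -
    have P: "ast u v = double_ast u v \<and> circ u v = double_circ u v"
      if "u \<in> range (\<lambda>x. (x, 0))" "v \<in> range (\<lambda>x. (x, 0))" for u v
      using that sub(1) base_subalgebra by (auto simp: subalgebra_via_def)
    have Q: "ast u v = double_ast u v \<and> circ u v = double_circ u v"
      if "u \<in> (\<lambda>a. (0, a)) ` dual" "v \<in> (\<lambda>a. (0, a)) ` dual" for u v
      using that sub(2) dual_subalgebra by (auto simp: subalgebra_via_def)
    show ?thesis
      using invariant_products_unique[OF inv P Q that] by blast
  qed
  then have "subalgebra_via (\<lambda>u. u) double ast circ double_ast double_circ"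
    unfolding subalgebra_via_def by auto
  from anti_pre_Poisson_image[OF q.anti_pre_Poisson_algebra_axioms vector_space_double _ _ this]
  show "anti_pre_Poisson_algebra double_scale double double_ast double_circ" by simp
next
  assume app: "anti_pre_Poisson_algebra double_scale double double_ast double_circ"
  interpret invariant_form double_scale double double_ast double_circ pairing
    by (rule double_invariant_form)
  have "quadratic_anti_pre_Poisson_algebra double_scale double double_ast double_circ pairing"
    by (intro quadratic_anti_pre_Poisson_algebra.intro quadratic_anti_pre_Poisson_algebra_axioms.intro app
      form_bilinear form_symmetric form_nondegenerate form_ast form_circ)
  then show "\<exists>ast circ. quadratic_anti_pre_Poisson_algebra double_scale double ast circ pairing \<and>
      subalgebra_via (\<lambda>x. (x, 0)) UNIV ast1 circ1 ast circ \<and>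
      subalgebra_via (\<lambda>a. (0, a)) dual ast2 circ2 ast circ"
    using base_subalgebra dual_subalgebra by blast
qed

lemma matched_pair_anti_pre_Poisson_iff_double:
  "matched_pair_anti_pre_Poisson
      s UNIV ast1 circ1
      dual_scale dual ast2 circ2
      (dual_action (Lmul ast1) + dual_action (Rmul ast1))
      (- dual_action (Rmul ast1))
      (dual_action (Rmul circ1) - dual_action (Lmul circ1))
      (dual_action (Rmul circ1))
      (bidual_action s (Lmul ast2) + bidual_action s (Rmul ast2))
      (- bidual_action s (Rmul ast2))
      (bidual_action s (Rmul circ2) - bidual_action s (Lmul circ2))
      (bidual_action s (Rmul circ2))
    \<longleftrightarrow> anti_pre_Poisson_algebra double_scale double double_ast double_circ"
proof -
  have "linear_to_End s UNIV dual_scale dual (dual_action (Lmul ast1) + dual_action (Rmul ast1))"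
    "linear_to_End s UNIV dual_scale dual (- dual_action (Rmul ast1))"
    "linear_to_End s UNIV dual_scale dual (dual_action (Rmul circ1) - dual_action (Lmul circ1))"
    "linear_to_End dual_scale dual s UNIV (bidual_action s (Lmul ast2) + bidual_action s (Rmul ast2))"
    "linear_to_End dual_scale dual s UNIV (- bidual_action s (Rmul ast2))"
    "linear_to_End dual_scale dual s UNIV (bidual_action s (Rmul circ2) - bidual_action s (Lmul circ2))"
    by (rule action_linear pointwise_linear)+
  then show ?thesis
    unfolding matched_pair_anti_pre_Poisson_def double_ast_def double_circ_def
    using A D action_linear by blast
qed

lemma matched_pair_Poisson_iff_double:
  "matched_pair_Poisson
      s UNIV (anticommutator ast1) (commutator circ1)
      dual_scale dual (anticommutator ast2) (commutator circ2)
      (dual_action (Lmul ast1)) (- dual_action (Lmul circ1))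
      (bidual_action s (Lmul ast2)) (- bidual_action s (Lmul circ2))
    \<longleftrightarrow> Poisson_algebra double_scale double (anticommutator double_ast) (commutator double_circ)"
proof -
  have "linear_to_End s UNIV dual_scale dual (- dual_action (Lmul circ1))"
    "linear_to_End dual_scale dual s UNIV (- bidual_action s (Lmul circ2))"
    by (rule action_linear pointwise_linear)+
  then show ?thesis
    unfolding matched_pair_Poisson_def anticommutator_double_ast commutator_double_circ
    using A.sub_adjacent_Poisson D.sub_adjacent_Poisson action_linear by blast
qed

lemma double_Poisson_iff_anti_pre_Poisson:
  assumes "(2::'k) \<noteq> 0"
  shows "Poisson_algebra double_scale double (anticommutator double_ast) (commutator double_circ)
    \<longleftrightarrow> anti_pre_Poisson_algebra double_scale double double_ast double_circ"
  using assms double_invariant_form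
  by (meson anti_pre_Poisson_algebra.sub_adjacent_Poisson invariant_form_Poisson.anti_pre_Poisson
      invariant_form_Poisson.intro invariant_form_Poisson_axioms.intro)

end


section \<open>The bialgebra equations\<close>

locale dual_coalgebra_pair = dual_algebra_pair s Basis ast1 circ1 "dual_mult \<Delta>" "dual_mult \<delta>"
  for s :: "'k::field \<Rightarrow> 'a::ab_group_add \<Rightarrow> 'a" and Basis ast1 circ1
    and \<Delta> \<delta> :: "'a \<Rightarrow> ('a \<Rightarrow> 'k) \<Rightarrow> ('a \<Rightarrow> 'k) \<Rightarrow> 'k" +
  assumes \<Delta>: "comultiplication s \<Delta>" and \<delta>: "comultiplication s \<delta>"
begin

abbreviation "star \<equiv> anticommutator ast1"
abbreviation "br \<equiv> commutator circ1"
abbreviation "La \<equiv> Lmul ast1"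
abbreviation "Ra \<equiv> Rmul ast1"
abbreviation "Ls \<equiv> La + Ra"
abbreviation "Lc \<equiv> Lmul circ1"
abbreviation "Rc \<equiv> Rmul circ1"
abbreviation "ad \<equiv> Lc - Rc"
abbreviation "T \<equiv> tensor_map s"
abbreviation "dstar \<equiv> anticommutator double_ast"
abbreviation "dbr \<equiv> commutator double_circ"

lemma tensor_eq_iff:
  assumes "\<And>a b. a \<notin> dual \<or> b \<notin> dual \<Longrightarrow> t a b = t' a b"
    and "\<And>a b. a \<in> dual \<Longrightarrow> b \<in> dual \<Longrightarrow> t a b = t' a b \<longleftrightarrow> R a b"
  shows "t = t' \<longleftrightarrow> (\<forall>a\<in>dual. \<forall>b\<in>dual. R a b)"
  using assms by (metis ext)

lemma comultiplication_off_dual: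
  "a \<notin> dual \<or> b \<notin> dual \<Longrightarrow> \<Delta> x a b = 0" "a \<notin> dual \<or> b \<notin> dual \<Longrightarrow> \<delta> x a b = 0"
  using \<Delta> \<delta> by (auto simp: comultiplication_def tensor_square_def)

lemma comultiplication_linear:
  "\<Delta> (x + y) a b = \<Delta> x a b + \<Delta> y a b" "\<Delta> (x - y) a b = \<Delta> x a b - \<Delta> y a b"
  "\<delta> (x + y) a b = \<delta> x a b + \<delta> y a b" "\<delta> (x - y) a b = \<delta> x a b - \<delta> y a b"
proof -
  have add: "\<Delta> (x + y) a b = \<Delta> x a b + \<Delta> y a b" "\<delta> (x + y) a b = \<delta> x a b + \<delta> y a b" for x y
    using \<Delta> \<delta> by (simp_all add: comultiplication_def Vector_Spaces.linear_iff)
  then show "\<Delta> (x + y) a b = \<Delta> x a b + \<Delta> y a b" "\<delta> (x + y) a b = \<delta> x a b + \<delta> y a b"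
    by blast+
  from add[of "x - y" y]
  show "\<Delta> (x - y) a b = \<Delta> x a b - \<Delta> y a b" "\<delta> (x - y) a b = \<delta> x a b - \<delta> y a b"
    by simp_all
qed

lemma base_mult_linear:
  "ast1 (x + y) z = ast1 x z + ast1 y z" "ast1 z (x + y) = ast1 z x + ast1 z y"
  "ast1 (x - y) z = ast1 x z - ast1 y z" "ast1 z (x - y) = ast1 z x - ast1 z y"
  "ast1 (- x) z = - ast1 x z" "ast1 z (- x) = - ast1 z x"
  "circ1 (x + y) z = circ1 x z + circ1 y z" "circ1 z (x + y) = circ1 z x + circ1 z y"
  "circ1 (x - y) z = circ1 x z - circ1 y z" "circ1 z (x - y) = circ1 z x - circ1 z y"
  "circ1 (- x) z = - circ1 x z" "circ1 z (- x) = - circ1 z x"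
  by (simp_all add: algebra_on.mult_add[OF base_algebras(1)] algebra_on.mult_add[OF base_algebras(2)]
    algebra_on.mult_diff[OF base_algebras(1)] algebra_on.mult_diff[OF base_algebras(2)]
    algebra_on.mult_minus[OF base_algebras(1)] algebra_on.mult_minus[OF base_algebras(2)])

lemma tensor_add:
  assumes "f \<in> dual" "g \<in> dual" "h \<in> dual"
  shows "\<Delta> x (\<lambda>v. f v + g v) h = \<Delta> x f h + \<Delta> x g h" "\<Delta> x h (\<lambda>v. f v + g v) = \<Delta> x h f + \<Delta> x h g"
    "\<Delta> x (\<lambda>v. f v - g v) h = \<Delta> x f h - \<Delta> x g h" "\<Delta> x h (\<lambda>v. f v - g v) = \<Delta> x h f - \<Delta> x h g"
    "\<delta> x (\<lambda>v. f v + g v) h = \<delta> x f h + \<delta> x g h" "\<delta> x h (\<lambda>v. f v + g v) = \<delta> x h f + \<delta> x h g"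
    "\<delta> x (\<lambda>v. f v - g v) h = \<delta> x f h - \<delta> x g h" "\<delta> x h (\<lambda>v. f v - g v) = \<delta> x h f - \<delta> x h g"
  using algebra_on.mult_add[OF dual_algebras(1)] algebra_on.mult_add[OF dual_algebras(2)]
    algebra_on.mult_diff[OF dual_algebras(1)] algebra_on.mult_diff[OF dual_algebras(2)] assms
  by (auto simp: dual_mult_def fun_eq_iff plus_fun_def fun_diff_def)

lemma tensor_minus:
  assumes "f \<in> dual" "h \<in> dual"
  shows "\<Delta> x (\<lambda>v. - f v) h = - \<Delta> x f h" "\<Delta> x h (\<lambda>v. - f v) = - \<Delta> x h f"
    "\<delta> x (\<lambda>v. - f v) h = - \<delta> x f h" "\<delta> x h (\<lambda>v. - f v) = - \<delta> x h f"
  using algebra_on.mult_minus[OF dual_algebras(1)] algebra_on.mult_minus[OF dual_algebras(2)] assms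
  by (auto simp: dual_mult_def fun_eq_iff fun_Compl_def)

lemma transpose_in_dual:
  assumes "b \<in> dual"
  shows "(\<lambda>v. b (ast1 x v)) \<in> dual" "(\<lambda>v. b (ast1 v x)) \<in> dual"
    "(\<lambda>v. b (circ1 x v)) \<in> dual" "(\<lambda>v. b (circ1 v x)) \<in> dual"
  using dual_linear(1,5)[OF assms]
  by (simp_all add: dual_space_iff vector_space_axioms base_mult_linear
    algebra_on.mult_scale[OF base_algebras(1)] algebra_on.mult_scale[OF base_algebras(2)])

lemma pointwise_in_dual:
  "f \<in> dual \<Longrightarrow> (\<lambda>v. - f v) \<in> dual"
  "f \<in> dual \<Longrightarrow> g \<in> dual \<Longrightarrow> (\<lambda>v. f v + g v) \<in> dual"
  "f \<in> dual \<Longrightarrow> g \<in> dual \<Longrightarrow> (\<lambda>v. f v - g v) \<in> dual"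
  by (simp_all add: dual_space_iff vector_space_axioms algebra_simps)

lemma product_in_dual:
  assumes "a \<in> dual" "b \<in> dual"
  shows "(\<lambda>v. \<Delta> v a b) \<in> dual" "(\<lambda>v. \<delta> v a b) \<in> dual"
  using algebra_on.mult_in[OF dual_algebras(1)] algebra_on.mult_in[OF dual_algebras(2)] assms
  by (simp_all add: dual_mult_def)

text \<open>
  These equations turn every pairing in the double into a combination of the scalars obtained by
  evaluating the comultiplications on \<open>a\<close>, \<open>b\<close> and their transposes under multiplications of \<open>A\<close>.
\<close>

lemma bidual_transpose_eval:
  assumes "a \<in> dual" "b \<in> dual"
  shows
    "b (ast1 x (bidual_action s (Lmul (dual_mult \<Delta>)) a y)) = - \<Delta> y a (\<lambda>v. b (ast1 x v))"
    "b (ast1 (bidual_action s (Lmul (dual_mult \<Delta>)) a y) x) = - \<Delta> y a (\<lambda>v. b (ast1 v x))"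
    "b (circ1 x (bidual_action s (Lmul (dual_mult \<Delta>)) a y)) = - \<Delta> y a (\<lambda>v. b (circ1 x v))"
    "b (circ1 (bidual_action s (Lmul (dual_mult \<Delta>)) a y) x) = - \<Delta> y a (\<lambda>v. b (circ1 v x))"
    "b (ast1 x (bidual_action s (Lmul (dual_mult \<delta>)) a y)) = - \<delta> y a (\<lambda>v. b (ast1 x v))"
    "b (ast1 (bidual_action s (Lmul (dual_mult \<delta>)) a y) x) = - \<delta> y a (\<lambda>v. b (ast1 v x))"
    "b (circ1 x (bidual_action s (Lmul (dual_mult \<delta>)) a y)) = - \<delta> y a (\<lambda>v. b (circ1 x v))"
    "b (circ1 (bidual_action s (Lmul (dual_mult \<delta>)) a y) x) = - \<delta> y a (\<lambda>v. b (circ1 v x))"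
    "b (bidual_action s (Lmul (dual_mult \<Delta>)) a y) = - \<Delta> y a b"
    "b (bidual_action s (Lmul (dual_mult \<delta>)) a y) = - \<delta> y a b"
  using assms bidual_eval(1,3)[OF assms(1) transpose_in_dual(1)[OF assms(2)]]
    bidual_eval(1,3)[OF assms(1) transpose_in_dual(2)[OF assms(2)]]
    bidual_eval(1,3)[OF assms(1) transpose_in_dual(3)[OF assms(2)]]
    bidual_eval(1,3)[OF assms(1) transpose_in_dual(4)[OF assms(2)]]
    bidual_eval(1,3)[OF assms]
  by (simp_all add: dual_mult_def)

lemma dstar_apply:
  "dstar (x, a) (y, b) = (ast1 x y + ast1 y x + bidual_action s (Lmul (dual_mult \<Delta>)) a y
      + bidual_action s (Lmul (dual_mult \<Delta>)) b x,
    \<lambda>v. \<Delta> v a b + \<Delta> v b a - b (ast1 x v) - a (ast1 y v))"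
  by (auto simp: anticommutator_double_ast anticommutator_def dual_eval dual_mult_def fun_eq_iff)

lemma dbr_apply:
  "dbr (x, a) (y, b) = (circ1 x y - circ1 y x - bidual_action s (Lmul (dual_mult \<delta>)) a y
      + bidual_action s (Lmul (dual_mult \<delta>)) b x,
    \<lambda>v. \<delta> v a b - \<delta> v b a + b (circ1 x v) - a (circ1 y v))"
  by (auto simp: commutator_double_circ commutator_def dual_eval dual_mult_def fun_eq_iff)

lemma tensor_zero:
  assumes "a \<in> dual"
  shows "\<Delta> x 0 a = 0" "\<Delta> x a 0 = 0" "\<delta> x 0 a = 0" "\<delta> x a 0 = 0"
  using mult_zero(5-8)[OF assms] by (simp_all add: dual_mult_def fun_eq_iff)

lemma zero_fun: "(\<lambda>v. 0) = 0"
  by (simp add: zero_fun_def)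

text \<open>
  In each of the eight comparisons below, the two equations have the same defect up to sign.
\<close>

lemma eq_iff_of_diff:
  fixes p q t t' :: 'k
  shows "p - q = t - t' \<Longrightarrow> t = t' \<longleftrightarrow> p = q" "p - q = - (t - t') \<Longrightarrow> t = t' \<longleftrightarrow> p = q"
  by auto

lemmas expand_double = dstar_apply dbr_apply action_zero tensor_zero mult_zero zero_dual zero_fun

lemmas expand_scalar = bidual_transpose_eval tensor_add tensor_minus comultiplication_linear
  base_mult_linear pointwise_in_dual product_in_dual

lemmas expand_tensor = tensor_map_def twist_def anticommutator_def[of ast1] commutator_def[of circ1] Lmul_def Rmul_def
  comultiplication_off_dual o_def

text \<open>
  The eight bialgebra equations correspond one by one to the eight mixed identities of the double. In
  each case the comultiplication of a product of \<open>x\<close> and \<open>y\<close>, at \<open>a\<close> and \<open>b\<close>, is the term in which the two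
  elements of \<open>A\<close> and the two functionals are multiplied separately; the other terms come from the two
  components of the mixed products. The first two equations are associativity, read in the summand
  \<open>A\<close> and in the dual.
\<close>

lemma Delta_star_iff_associative:
  "\<Delta> (star x y) = T id (Ls x) (\<Delta> y) - T (La y) id (\<Delta> x) \<longleftrightarrow>
    (\<forall>a\<in>dual. \<forall>b\<in>dual. pairing (dstar (dstar (x, 0) (y, 0)) (0, a)) (0, b)
      = pairing (dstar (x, 0) (dstar (y, 0) (0, a))) (0, b))"
proof (rule tensor_eq_iff, goal_cases)
  case (1 a b) then show ?case by (auto simp: expand_tensor)
next
  case (2 a b)
  note functionals = 2 dual_linear[OF 2(1)] dual_linear[OF 2(2)]
    transpose_in_dual[OF 2(1)] transpose_in_dual[OF 2(2)]
  show ?case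
    by (rule eq_iff_of_diff; simp add: expand_double expand_tensor expand_scalar functionals algebra_simps)
qed

lemma Delta_ast_iff_associative:
  "(\<Delta> + (twist \<circ> \<Delta>)) (ast1 x y) = T (La x) id ((\<Delta> + (twist \<circ> \<Delta>)) y) - T id (Ra y) (\<Delta> x) \<longleftrightarrow>
    (\<forall>a\<in>dual. \<forall>b\<in>dual. pairing (dstar (dstar (0, b) (0, a)) (x, 0)) (y, 0)
      = pairing (dstar (0, b) (dstar (0, a) (x, 0))) (y, 0))"
proof (rule tensor_eq_iff, goal_cases)
  case (1 a b) then show ?case by (auto simp: expand_tensor)
next
  case (2 a b)
  note functionals = 2 dual_linear[OF 2(1)] dual_linear[OF 2(2)]
    transpose_in_dual[OF 2(1)] transpose_in_dual[OF 2(2)]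
  show ?case
    by (rule eq_iff_of_diff; simp add: expand_double expand_tensor expand_scalar functionals algebra_simps)
qed

text \<open>
  The Jacobi identity, with \<open>x\<close> and \<open>y\<close> acting on a functional in the first equation and with \<open>a\<close> and \<open>b\<close>
  acting on an element of \<open>A\<close> in the second. There the operator \<open>id - twist\<close> produces the bracket of \<open>a\<close> and \<open>b\<close>.
\<close>

lemma delta_br_iff_jacobi:
  "\<delta> (br x y) = (T id (ad x) - T (Lc x) id) (\<delta> y) - (T id (ad y) - T (Lc y) id) (\<delta> x) \<longleftrightarrow>
    (\<forall>a\<in>dual. \<forall>b\<in>dual. pairing (dbr (dbr (x, 0) (y, 0)) (0, a)) (0, b)
      = pairing (dbr (x, 0) (dbr (y, 0) (0, a))) (0, b) - pairing (dbr (y, 0) (dbr (x, 0) (0, a))) (0, b))"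
proof (rule tensor_eq_iff, goal_cases)
  case (1 a b) then show ?case by (auto simp: expand_tensor)
next
  case (2 a b)
  note functionals = 2 dual_linear[OF 2(1)] dual_linear[OF 2(2)]
    transpose_in_dual[OF 2(1)] transpose_in_dual[OF 2(2)]
  show ?case
    by (rule eq_iff_of_diff; simp add: expand_double expand_tensor expand_scalar functionals algebra_simps)
qed

lemma delta_circ_iff_jacobi:
  "(id - twist) (\<delta> (circ1 x y) - T (Lc x) id (\<delta> y) - T id (Lc x) (\<delta> y) + T id (Rc y) (\<delta> x)) = 0 \<longleftrightarrow>
    (\<forall>a\<in>dual. \<forall>b\<in>dual. pairing (dbr (dbr (0, a) (0, b)) (x, 0)) (y, 0)
      = pairing (dbr (0, a) (dbr (0, b) (x, 0))) (y, 0) - pairing (dbr (0, b) (dbr (0, a) (x, 0))) (y, 0))"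
proof (rule tensor_eq_iff, goal_cases)
  case (1 a b) then show ?case by (auto simp: expand_tensor)
next
  case (2 a b)
  note functionals = 2 dual_linear[OF 2(1)] dual_linear[OF 2(2)]
    transpose_in_dual[OF 2(1)] transpose_in_dual[OF 2(2)]
  show ?case
    by (rule eq_iff_of_diff; simp add: expand_double expand_tensor expand_scalar functionals algebra_simps)
qed

text \<open>
  In the four instances of the Leibniz rule, the acting element comes from the dual, from \<open>A\<close>, from \<open>A\<close> and
  from the dual, respectively. The first two are read in \<open>A\<close> and the last two in the dual, where \<open>\<Delta> + twist \<circ> \<Delta>\<close>
  and \<open>\<delta> - twist \<circ> \<delta>\<close> produce the star product and the bracket of \<open>a\<close> and \<open>b\<close>.
\<close>

lemma delta_star_iff_leibniz:
  "\<delta> (star x y) = T id (Ls x) (\<delta> y) + T id (Ls y) (\<delta> x)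
        + T (Lc x) id (\<Delta> y) + T (Lc y) id (\<Delta> x) \<longleftrightarrow>
    (\<forall>a\<in>dual. \<forall>b\<in>dual. pairing (dbr (0, a) (dstar (x, 0) (y, 0))) (0, b)
      = pairing (dstar (dbr (0, a) (x, 0)) (y, 0)) (0, b) + pairing (dstar (x, 0) (dbr (0, a) (y, 0))) (0, b))"
proof (rule tensor_eq_iff, goal_cases)
  case (1 a b) then show ?case by (auto simp: expand_tensor)
next
  case (2 a b)
  note functionals = 2 dual_linear[OF 2(1)] dual_linear[OF 2(2)]
    transpose_in_dual[OF 2(1)] transpose_in_dual[OF 2(2)]
  show ?case
    by (rule eq_iff_of_diff; simp add: expand_double expand_tensor expand_scalar functionals algebra_simps)
qed

lemma Delta_br_iff_leibniz:
  "\<Delta> (br x y) = - T (Lc x) id (\<Delta> y) - T id (Ls y) (\<delta> x) - T (La y) id (\<delta> x) + T id (ad x) (\<Delta> y) \<longleftrightarrow>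
    (\<forall>a\<in>dual. \<forall>b\<in>dual. pairing (dbr (x, 0) (dstar (y, 0) (0, a))) (0, b)
      = pairing (dstar (dbr (x, 0) (y, 0)) (0, a)) (0, b) + pairing (dstar (y, 0) (dbr (x, 0) (0, a))) (0, b))"
proof (rule tensor_eq_iff, goal_cases)
  case (1 a b) then show ?case by (auto simp: expand_tensor)
next
  case (2 a b)
  note functionals = 2 dual_linear[OF 2(1)] dual_linear[OF 2(2)]
    transpose_in_dual[OF 2(1)] transpose_in_dual[OF 2(2)]
  show ?case
    by (rule eq_iff_of_diff; simp add: expand_double expand_tensor expand_scalar functionals algebra_simps)
qed

lemma Delta_circ_iff_leibniz:
  "(\<Delta> + (twist \<circ> \<Delta>)) (circ1 x y) =
        (id + twist) (T (Lc x) id (\<Delta> y) + T id (Lc x) (\<Delta> y) + T id (Ra y) (\<delta> x)) \<longleftrightarrow>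
    (\<forall>a\<in>dual. \<forall>b\<in>dual. pairing (dbr (x, 0) (dstar (0, a) (0, b))) (y, 0)
      = pairing (dstar (dbr (x, 0) (0, a)) (0, b)) (y, 0) + pairing (dstar (0, a) (dbr (x, 0) (0, b))) (y, 0))"
proof (rule tensor_eq_iff, goal_cases)
  case (1 a b) then show ?case by (auto simp: expand_tensor)
next
  case (2 a b)
  note functionals = 2 dual_linear[OF 2(1)] dual_linear[OF 2(2)]
    transpose_in_dual[OF 2(1)] transpose_in_dual[OF 2(2)]
  show ?case
    by (rule eq_iff_of_diff; simp add: expand_double expand_tensor expand_scalar functionals algebra_simps)
qed

lemma delta_ast_iff_leibniz:
  "\<delta> (ast1 x y) - twist (\<delta> (ast1 x y)) =
        T id (La x) (\<delta> y) - twist (T (La x) id (\<delta> y)) - T (Lc x) id (\<Delta> y)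
        - twist (T id (Lc x) (\<Delta> y)) - T id (Ra y) (\<delta> x) - twist (T id (Rc y) (\<Delta> x)) \<longleftrightarrow>
    (\<forall>a\<in>dual. \<forall>b\<in>dual. pairing (dbr (0, a) (dstar (0, b) (x, 0))) (y, 0)
      = pairing (dstar (dbr (0, a) (0, b)) (x, 0)) (y, 0) + pairing (dstar (0, b) (dbr (0, a) (x, 0))) (y, 0))"
proof (rule tensor_eq_iff, goal_cases)
  case (1 a b) then show ?case by (auto simp: expand_tensor)
next
  case (2 a b)
  note functionals = 2 dual_linear[OF 2(1)] dual_linear[OF 2(2)]
    transpose_in_dual[OF 2(1)] transpose_in_dual[OF 2(2)]
  show ?case
    by (rule eq_iff_of_diff; simp add: expand_double expand_tensor expand_scalar functionals algebra_simps)
qed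

theorem bialgebra_iff_double_Poisson:
  "anti_pre_Poisson_bialgebra s ast1 circ1 \<Delta> \<delta>
    \<longleftrightarrow> Poisson_algebra double_scale double (anticommutator double_ast) (commutator double_circ)"
proof -
  interpret W: polarised_invariant_form double_scale double double_ast double_circ pairing
    "range (\<lambda>x. (x, 0))" "(\<lambda>a. (0, a)) ` dual" by (rule double_polarised)
  have "anti_pre_Poisson_coalgebra s \<Delta> \<delta>"
    using \<Delta> \<delta> D by (simp add: anti_pre_Poisson_coalgebra_def)
  with A have "anti_pre_Poisson_bialgebra s ast1 circ1 \<Delta> \<delta> \<longleftrightarrow>
      W.mixed_identities (range (\<lambda>x. (x, 0))) ((\<lambda>a. (0, a)) ` dual) \<and>
      W.mixed_identities ((\<lambda>a. (0, a)) ` dual) (range (\<lambda>x. (x, 0)))"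
    unfolding anti_pre_Poisson_bialgebra_def Let_def W.mixed_identities_def
      Delta_star_iff_associative Delta_ast_iff_associative delta_br_iff_jacobi delta_circ_iff_jacobi
      delta_star_iff_leibniz Delta_br_iff_leibniz Delta_circ_iff_leibniz delta_ast_iff_leibniz ball_simps
    by blast
  then show ?thesis
    using W.Poisson_iff_mixed_identities by simp
qed

end

section \<open>The four equivalent conditions\<close>

theorem theorem3p16:
  fixes s :: "'k::field \<Rightarrow> 'a::ab_group_add \<Rightarrow> 'a" and Basis :: "'a set"
    and ast1 circ1 :: "'a \<Rightarrow> 'a \<Rightarrow> 'a"
    and \<Delta> \<delta> :: "'a \<Rightarrow> ('a \<Rightarrow> 'k) \<Rightarrow> ('a \<Rightarrow> 'k) \<Rightarrow> 'k"
    and ast2 circ2 :: "('a \<Rightarrow> 'k) \<Rightarrow> ('a \<Rightarrow> 'k) \<Rightarrow> ('a \<Rightarrow> 'k)"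
  assumes "finite_dimensional_vector_space s Basis"
    and "(2::'k) \<noteq> 0"
    and "anti_pre_Poisson_algebra s UNIV ast1 circ1"
    and "comultiplication s \<Delta>" and "comultiplication s \<delta>"
    and "ast2 = dual_mult \<Delta>" and "circ2 = dual_mult \<delta>"
    and "anti_pre_Poisson_algebra dual_scale (dual_space s) ast2 circ2"
  shows
    "((\<exists>ast circ.
        quadratic_anti_pre_Poisson_algebra (sum_scale s dual_scale) (UNIV \<times> dual_space s) ast circ
          (\<lambda>(x, a) (y, b). b x + a y) \<and>
        subalgebra_via (\<lambda>x. (x, 0)) UNIV ast1 circ1 ast circ \<and>
        subalgebra_via (\<lambda>a. (0, a)) (dual_space s) ast2 circ2 ast circ)
      \<longleftrightarrow>
      matched_pair_Poisson
        s UNIV (anticommutator ast1) (commutator circ1)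
        dual_scale (dual_space s) (anticommutator ast2) (commutator circ2)
        (dual_action (Lmul ast1)) (- dual_action (Lmul circ1))
        (bidual_action s (Lmul ast2)) (- bidual_action s (Lmul circ2)))
     \<and>
     (matched_pair_Poisson
        s UNIV (anticommutator ast1) (commutator circ1)
        dual_scale (dual_space s) (anticommutator ast2) (commutator circ2)
        (dual_action (Lmul ast1)) (- dual_action (Lmul circ1))
        (bidual_action s (Lmul ast2)) (- bidual_action s (Lmul circ2))
      \<longleftrightarrow>
      matched_pair_anti_pre_Poisson
        s UNIV ast1 circ1
        dual_scale (dual_space s) ast2 circ2
        (dual_action (Lmul ast1) + dual_action (Rmul ast1))
        (- dual_action (Rmul ast1))
        (dual_action (Rmul circ1) - dual_action (Lmul circ1))
        (dual_action (Rmul circ1))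
        (bidual_action s (Lmul ast2) + bidual_action s (Rmul ast2))
        (- bidual_action s (Rmul ast2))
        (bidual_action s (Rmul circ2) - bidual_action s (Lmul circ2))
        (bidual_action s (Rmul circ2)))
     \<and>
     (matched_pair_anti_pre_Poisson
        s UNIV ast1 circ1
        dual_scale (dual_space s) ast2 circ2
        (dual_action (Lmul ast1) + dual_action (Rmul ast1))
        (- dual_action (Rmul ast1))
        (dual_action (Rmul circ1) - dual_action (Lmul circ1))
        (dual_action (Rmul circ1))
        (bidual_action s (Lmul ast2) + bidual_action s (Rmul ast2))
        (- bidual_action s (Rmul ast2))
        (bidual_action s (Rmul circ2) - bidual_action s (Lmul circ2))
        (bidual_action s (Rmul circ2))
      \<longleftrightarrow>
      anti_pre_Poisson_bialgebra s ast1 circ1 \<Delta> \<delta>)"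
proof -
  interpret dual_coalgebra_pair s Basis ast1 circ1 \<Delta> \<delta>
    using assms by (intro dual_coalgebra_pair.intro dual_algebra_pair.intro
      dual_algebra_pair_axioms.intro dual_coalgebra_pair_axioms.intro) simp_all
  show ?thesis
    unfolding \<open>ast2 = dual_mult \<Delta>\<close> \<open>circ2 = dual_mult \<delta>\<close>
      quadratic_iff_double matched_pair_Poisson_iff_double matched_pair_anti_pre_Poisson_iff_double
      bialgebra_iff_double_Poisson double_Poisson_iff_anti_pre_Poisson[OF \<open>(2::'k) \<noteq> 0\<close>]
    by simp
qed

end
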